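(* Let $(\mathcal{C},\otimes)$ be an Abelian tensor category in which countable products exist. Assume: 1. $\otimes$ is exact; 2. for all countable families $(X_i)_{i\in\mathbb{N}}$ and all $Y$ the canonical morphism $(\prod_{i\in\mathbb{N}}X_i)\otimes Y\to\prod_{i\in\mathbb{N}}(X_i\otimes Y)$ is a monomorphism; 3. $\otimes$ commutes with countable intersections (of subobjects). Then the forgetful functor $\mathrm{Coalg}(\mathcal{C},\otimes)\to\mathcal{C}$ has a right adjoint (cofree coalgebra functor).
   Context: An Abelian tensor category is an abelian category with a monoidal structure $\otimes$ (with unit $1$) that is additive in each variable. $\mathrm{Coalg}(\mathcal{C},\otimes)$ is the category of coassociative counital coalgebras in $(\mathcal{C},\otimes)$. *)

theory Defs
  imports "HOL-Algebra.Group"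
begin

section \<open>Categories, functors and adjunctions\<close>

record ('o, 'a) category =
  Ob :: "'o set"
  Arr :: "'a set"
  Dom :: "'a \<Rightarrow> 'o"
  Cod :: "'a \<Rightarrow> 'o"
  Idn :: "'o \<Rightarrow> 'a"
  Comp :: "'a \<Rightarrow> 'a \<Rightarrow> 'a"  (infixr \<open>\<cdot>\<index>\<close> 75)

definition Hom :: "('o, 'a, 'm) category_scheme \<Rightarrow> 'o \<Rightarrow> 'o \<Rightarrow> 'a set" where
  "Hom C A B = {f \<in> Arr C. Dom C f = A \<and> Cod C f = B}"

locale category =
  fixes C :: "('o, 'a, 'm) category_scheme" (structure)
  assumes Dom_in_Ob: "f \<in> Arr C \<Longrightarrow> Dom C f \<in> Ob C"
    and Cod_in_Ob: "f \<in> Arr C \<Longrightarrow> Cod C f \<in> Ob C"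
    and Idn_in_Hom: "A \<in> Ob C \<Longrightarrow> Idn C A \<in> Hom C A A"
    and Comp_in_Hom: "\<lbrakk>f \<in> Hom C A B; g \<in> Hom C B D\<rbrakk> \<Longrightarrow> g \<cdot> f \<in> Hom C A D"
    and Comp_Idn: "f \<in> Hom C A B \<Longrightarrow> f \<cdot> Idn C A = f"
    and Idn_Comp: "f \<in> Hom C A B \<Longrightarrow> Idn C B \<cdot> f = f"
    and Comp_assoc:
      "\<lbrakk>f \<in> Hom C A B; g \<in> Hom C B D; h \<in> Hom C D E\<rbrakk> \<Longrightarrow> (h \<cdot> g) \<cdot> f = h \<cdot> (g \<cdot> f)"

definition is_mono :: "('o, 'a, 'm) category_scheme \<Rightarrow> 'a \<Rightarrow> bool" where
  "is_mono C m \<longleftrightarrow> m \<in> Arr C \<and>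
    (\<forall>A \<in> Ob C. \<forall>f \<in> Hom C A (Dom C m). \<forall>g \<in> Hom C A (Dom C m).
      m \<cdot>\<^bsub>C\<^esub> f = m \<cdot>\<^bsub>C\<^esub> g \<longrightarrow> f = g)"

definition is_epi :: "('o, 'a, 'm) category_scheme \<Rightarrow> 'a \<Rightarrow> bool" where
  "is_epi C e \<longleftrightarrow> e \<in> Arr C \<and>
    (\<forall>B \<in> Ob C. \<forall>f \<in> Hom C (Cod C e) B. \<forall>g \<in> Hom C (Cod C e) B.
      f \<cdot>\<^bsub>C\<^esub> e = g \<cdot>\<^bsub>C\<^esub> e \<longrightarrow> f = g)"

definition is_iso :: "('o, 'a, 'm) category_scheme \<Rightarrow> 'a \<Rightarrow> bool" where
  "is_iso C f \<longleftrightarrow> f \<in> Arr C \<and>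
    (\<exists>g \<in> Hom C (Cod C f) (Dom C f).
      g \<cdot>\<^bsub>C\<^esub> f = Idn C (Dom C f) \<and> f \<cdot>\<^bsub>C\<^esub> g = Idn C (Cod C f))"

definition is_product ::
    "('o, 'a, 'm) category_scheme \<Rightarrow> 'i set \<Rightarrow> ('i \<Rightarrow> 'o) \<Rightarrow> 'o \<Rightarrow> ('i \<Rightarrow> 'a) \<Rightarrow> bool" where
  "is_product C I X P p \<longleftrightarrow> P \<in> Ob C \<and> (\<forall>i \<in> I. p i \<in> Hom C P (X i)) \<and>
    (\<forall>A \<in> Ob C. \<forall>f. (\<forall>i \<in> I. f i \<in> Hom C A (X i)) \<longrightarrow>
      (\<exists>!h. h \<in> Hom C A P \<and> (\<forall>i \<in> I. p i \<cdot>\<^bsub>C\<^esub> h = f i)))"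

definition has_countable_products :: "('o, 'a, 'm) category_scheme \<Rightarrow> bool" where
  "has_countable_products C \<longleftrightarrow>
    (\<forall>(I :: nat set) X. (\<forall>i \<in> I. X i \<in> Ob C) \<longrightarrow> (\<exists>P p. is_product C I X P p))"

text \<open>
  A subobject of \<open>B\<close> is given by a representing monomorphism with codomain \<open>B\<close>.
  The monomorphism \<open>u\<close> is an intersection of the family \<open>m\<close> of subobjects of \<open>B\<close> if it
  is contained in all of them and every morphism into \<open>B\<close> that factors through each
  \<open>m i\<close> factors (necessarily uniquely) through \<open>u\<close>.
\<close>

definition is_subobject :: "('o, 'a, 'm) category_scheme \<Rightarrow> 'o \<Rightarrow> 'a \<Rightarrow> bool" where
  "is_subobject C B m \<longleftrightarrow> is_mono C m \<and> Cod C m = B"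

definition factors_through :: "('o, 'a, 'm) category_scheme \<Rightarrow> 'a \<Rightarrow> 'a \<Rightarrow> bool" where
  "factors_through C f m \<longleftrightarrow> (\<exists>h \<in> Hom C (Dom C f) (Dom C m). f = m \<cdot>\<^bsub>C\<^esub> h)"

definition is_intersection ::
    "('o, 'a, 'm) category_scheme \<Rightarrow> 'o \<Rightarrow> 'i set \<Rightarrow> ('i \<Rightarrow> 'a) \<Rightarrow> 'a \<Rightarrow> bool" where
  "is_intersection C B I m u \<longleftrightarrow> B \<in> Ob C \<and> (\<forall>i \<in> I. is_subobject C B (m i)) \<and>
    is_subobject C B u \<and> (\<forall>i \<in> I. factors_through C u (m i)) \<and>
    (\<forall>f \<in> Arr C. Cod C f = B \<longrightarrow> (\<forall>i \<in> I. factors_through C f (m i)) \<longrightarrow>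
      factors_through C f u)"

record ('o, 'a, 'p, 'b) cat_functor =
  ObMap :: "'o \<Rightarrow> 'p"
  ArrMap :: "'a \<Rightarrow> 'b"

definition is_functor ::
    "('o, 'a, 'm) category_scheme \<Rightarrow> ('p, 'b, 'n) category_scheme
      \<Rightarrow> ('o, 'a, 'p, 'b) cat_functor \<Rightarrow> bool" where
  "is_functor C D F \<longleftrightarrow> category C \<and> category D \<and>
    (\<forall>A \<in> Ob C. ObMap F A \<in> Ob D) \<and>
    (\<forall>A B. \<forall>f \<in> Hom C A B. ArrMap F f \<in> Hom D (ObMap F A) (ObMap F B)) \<and>
    (\<forall>A \<in> Ob C. ArrMap F (Idn C A) = Idn D (ObMap F A)) \<and>
    (\<forall>A B E. \<forall>f \<in> Hom C A B. \<forall>g \<in> Hom C B E.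
      ArrMap F (g \<cdot>\<^bsub>C\<^esub> f) = ArrMap F g \<cdot>\<^bsub>D\<^esub> ArrMap F f)"

text \<open>
  \<open>G\<close> is right adjoint to \<open>F : C \<rightarrow> D\<close>, witnessed by a bijection
  \<open>Hom D (F A) X \<cong> Hom C A (G X)\<close> natural in \<open>A\<close> and \<open>X\<close>.
\<close>

definition is_adjunction ::
    "('o, 'a, 'm) category_scheme \<Rightarrow> ('p, 'b, 'n) category_scheme
      \<Rightarrow> ('o, 'a, 'p, 'b) cat_functor \<Rightarrow> ('p, 'b, 'o, 'a) cat_functor
      \<Rightarrow> ('o \<Rightarrow> 'p \<Rightarrow> 'b \<Rightarrow> 'a) \<Rightarrow> bool" where
  "is_adjunction C D F G \<phi> \<longleftrightarrow> is_functor C D F \<and> is_functor D C G \<and>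
    (\<forall>A \<in> Ob C. \<forall>X \<in> Ob D.
      bij_betw (\<phi> A X) (Hom D (ObMap F A) X) (Hom C A (ObMap G X))) \<and>
    (\<forall>A \<in> Ob C. \<forall>A' \<in> Ob C. \<forall>X \<in> Ob D. \<forall>X' \<in> Ob D.
      \<forall>h \<in> Hom C A' A. \<forall>k \<in> Hom D X X'. \<forall>g \<in> Hom D (ObMap F A) X.
        \<phi> A' X' (k \<cdot>\<^bsub>D\<^esub> g \<cdot>\<^bsub>D\<^esub> ArrMap F h) = ArrMap G k \<cdot>\<^bsub>C\<^esub> \<phi> A X g \<cdot>\<^bsub>C\<^esub> h)"

definition has_right_adjoint ::
    "('o, 'a, 'm) category_scheme \<Rightarrow> ('p, 'b, 'n) category_scheme
      \<Rightarrow> ('o, 'a, 'p, 'b) cat_functor \<Rightarrow> bool" where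
  "has_right_adjoint C D F \<longleftrightarrow> (\<exists>G \<phi>. is_adjunction C D F G \<phi>)"


section \<open>Abelian categories\<close>

record ('o, 'a) preadditive_category = "('o, 'a) category" +
  Plus :: "'a \<Rightarrow> 'a \<Rightarrow> 'a"  (infixl \<open>\<oplus>\<index>\<close> 65)
  Zero :: "'o \<Rightarrow> 'o \<Rightarrow> 'a"

definition Hom_group :: "('o, 'a, 'm) preadditive_category_scheme \<Rightarrow> 'o \<Rightarrow> 'o \<Rightarrow> 'a monoid" where
  "Hom_group C A B = \<lparr>carrier = Hom C A B, mult = Plus C, one = Zero C A B\<rparr>"

locale preadditive_category = category C
  for C :: "('o, 'a, 'm) preadditive_category_scheme" (structure) +
  assumes Hom_comm_group: "\<lbrakk>A \<in> Ob C; B \<in> Ob C\<rbrakk> \<Longrightarrow> comm_group (Hom_group C A B)"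
    and Comp_Plus: "\<lbrakk>f \<in> Hom C A B; f' \<in> Hom C A B; g \<in> Hom C B D\<rbrakk>
      \<Longrightarrow> g \<cdot> (f \<oplus> f') = (g \<cdot> f) \<oplus> (g \<cdot> f')"
    and Plus_Comp: "\<lbrakk>f \<in> Hom C A B; g \<in> Hom C B D; g' \<in> Hom C B D\<rbrakk>
      \<Longrightarrow> (g \<oplus> g') \<cdot> f = (g \<cdot> f) \<oplus> (g' \<cdot> f)"

definition is_zero_object :: "('o, 'a, 'm) category_scheme \<Rightarrow> 'o \<Rightarrow> bool" where
  "is_zero_object C Z \<longleftrightarrow> Z \<in> Ob C \<and>
    (\<forall>A \<in> Ob C. (\<exists>!f. f \<in> Hom C Z A) \<and> (\<exists>!f. f \<in> Hom C A Z))"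

definition is_biproduct ::
    "('o, 'a, 'm) preadditive_category_scheme \<Rightarrow> 'o \<Rightarrow> 'o \<Rightarrow> 'o
      \<Rightarrow> 'a \<Rightarrow> 'a \<Rightarrow> 'a \<Rightarrow> 'a \<Rightarrow> bool" where
  "is_biproduct C A B S i j p q \<longleftrightarrow> S \<in> Ob C \<and>
    i \<in> Hom C A S \<and> j \<in> Hom C B S \<and> p \<in> Hom C S A \<and> q \<in> Hom C S B \<and>
    p \<cdot>\<^bsub>C\<^esub> i = Idn C A \<and> q \<cdot>\<^bsub>C\<^esub> j = Idn C B \<and>
    p \<cdot>\<^bsub>C\<^esub> j = Zero C B A \<and> q \<cdot>\<^bsub>C\<^esub> i = Zero C A B \<and>
    (i \<cdot>\<^bsub>C\<^esub> p) \<oplus>\<^bsub>C\<^esub> (j \<cdot>\<^bsub>C\<^esub> q) = Idn C S"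

definition is_kernel :: "('o, 'a, 'm) preadditive_category_scheme \<Rightarrow> 'a \<Rightarrow> 'a \<Rightarrow> bool" where
  "is_kernel C k f \<longleftrightarrow> f \<in> Arr C \<and> k \<in> Arr C \<and> Cod C k = Dom C f \<and>
    f \<cdot>\<^bsub>C\<^esub> k = Zero C (Dom C k) (Cod C f) \<and>
    (\<forall>A \<in> Ob C. \<forall>g \<in> Hom C A (Dom C f). f \<cdot>\<^bsub>C\<^esub> g = Zero C A (Cod C f) \<longrightarrow>
      (\<exists>!h. h \<in> Hom C A (Dom C k) \<and> k \<cdot>\<^bsub>C\<^esub> h = g))"

definition is_cokernel :: "('o, 'a, 'm) preadditive_category_scheme \<Rightarrow> 'a \<Rightarrow> 'a \<Rightarrow> bool" where
  "is_cokernel C c f \<longleftrightarrow> f \<in> Arr C \<and> c \<in> Arr C \<and> Dom C c = Cod C f \<and>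
    c \<cdot>\<^bsub>C\<^esub> f = Zero C (Dom C f) (Cod C c) \<and>
    (\<forall>B \<in> Ob C. \<forall>g \<in> Hom C (Cod C f) B. g \<cdot>\<^bsub>C\<^esub> f = Zero C (Dom C f) B \<longrightarrow>
      (\<exists>!h. h \<in> Hom C (Cod C c) B \<and> h \<cdot>\<^bsub>C\<^esub> c = g))"

locale abelian_category = preadditive_category C
  for C :: "('o, 'a, 'm) preadditive_category_scheme" (structure) +
  assumes ex_zero_object: "\<exists>Z. is_zero_object C Z"
    and ex_biproduct:
      "\<lbrakk>A \<in> Ob C; B \<in> Ob C\<rbrakk> \<Longrightarrow> \<exists>S i j p q. is_biproduct C A B S i j p q"
    and ex_kernel: "f \<in> Arr C \<Longrightarrow> \<exists>k. is_kernel C k f"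
    and ex_cokernel: "f \<in> Arr C \<Longrightarrow> \<exists>c. is_cokernel C c f"
    and mono_normal: "is_mono C m \<Longrightarrow> \<exists>f. is_kernel C m f"
    and epi_normal: "is_epi C e \<Longrightarrow> \<exists>f. is_cokernel C e f"

text \<open>The sequence \<open>0 \<rightarrow> Dom f \<rightarrow> Cod f = Dom g \<rightarrow> Cod g \<rightarrow> 0\<close> is exact.\<close>

definition short_exact :: "('o, 'a, 'm) preadditive_category_scheme \<Rightarrow> 'a \<Rightarrow> 'a \<Rightarrow> bool" where
  "short_exact C f g \<longleftrightarrow> is_kernel C f g \<and> is_cokernel C g f"


section \<open>Abelian tensor categories\<close>

text \<open>
  The associator goes from \<open>(A \<otimes> B) \<otimes> D\<close> to \<open>A \<otimes> (B \<otimes> D)\<close>; the unitors go from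
  \<open>1 \<otimes> A\<close> and \<open>A \<otimes> 1\<close> to \<open>A\<close>. No braiding or symmetry is assumed.
\<close>

record ('o, 'a) tensor_category = "('o, 'a) preadditive_category" +
  TensOb :: "'o \<Rightarrow> 'o \<Rightarrow> 'o"  (infixl \<open>\<odot>\<index>\<close> 80)
  TensArr :: "'a \<Rightarrow> 'a \<Rightarrow> 'a"  (infixl \<open>\<boxtimes>\<index>\<close> 80)
  TUnit :: "'o"
  Assoc :: "'o \<Rightarrow> 'o \<Rightarrow> 'o \<Rightarrow> 'a"
  LUnit :: "'o \<Rightarrow> 'a"
  RUnit :: "'o \<Rightarrow> 'a"

locale monoidal_category = category C
  for C :: "('o, 'a, 'm) tensor_category_scheme" (structure) +
  assumes TensOb_in_Ob: "\<lbrakk>A \<in> Ob C; B \<in> Ob C\<rbrakk> \<Longrightarrow> A \<odot> B \<in> Ob C"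
    and TUnit_in_Ob: "TUnit C \<in> Ob C"
    and TensArr_in_Hom: "\<lbrakk>f \<in> Hom C A A'; g \<in> Hom C B B'\<rbrakk>
      \<Longrightarrow> f \<boxtimes> g \<in> Hom C (A \<odot> B) (A' \<odot> B')"
    and TensArr_Idn: "\<lbrakk>A \<in> Ob C; B \<in> Ob C\<rbrakk> \<Longrightarrow> Idn C A \<boxtimes> Idn C B = Idn C (A \<odot> B)"
    and TensArr_Comp: "\<lbrakk>f \<in> Hom C A A'; f' \<in> Hom C A' A''; g \<in> Hom C B B'; g' \<in> Hom C B' B''\<rbrakk>
      \<Longrightarrow> (f' \<cdot> f) \<boxtimes> (g' \<cdot> g) = (f' \<boxtimes> g') \<cdot> (f \<boxtimes> g)"
    and Assoc_in_Hom: "\<lbrakk>A \<in> Ob C; B \<in> Ob C; D \<in> Ob C\<rbrakk>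
      \<Longrightarrow> Assoc C A B D \<in> Hom C ((A \<odot> B) \<odot> D) (A \<odot> (B \<odot> D))"
    and Assoc_iso: "\<lbrakk>A \<in> Ob C; B \<in> Ob C; D \<in> Ob C\<rbrakk> \<Longrightarrow> is_iso C (Assoc C A B D)"
    and Assoc_natural: "\<lbrakk>f \<in> Hom C A A'; g \<in> Hom C B B'; h \<in> Hom C D D'\<rbrakk>
      \<Longrightarrow> Assoc C A' B' D' \<cdot> ((f \<boxtimes> g) \<boxtimes> h) = (f \<boxtimes> (g \<boxtimes> h)) \<cdot> Assoc C A B D"
    and LUnit_in_Hom: "A \<in> Ob C \<Longrightarrow> LUnit C A \<in> Hom C (TUnit C \<odot> A) A"
    and LUnit_iso: "A \<in> Ob C \<Longrightarrow> is_iso C (LUnit C A)"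
    and LUnit_natural: "f \<in> Hom C A B
      \<Longrightarrow> LUnit C B \<cdot> (Idn C (TUnit C) \<boxtimes> f) = f \<cdot> LUnit C A"
    and RUnit_in_Hom: "A \<in> Ob C \<Longrightarrow> RUnit C A \<in> Hom C (A \<odot> TUnit C) A"
    and RUnit_iso: "A \<in> Ob C \<Longrightarrow> is_iso C (RUnit C A)"
    and RUnit_natural: "f \<in> Hom C A B
      \<Longrightarrow> RUnit C B \<cdot> (f \<boxtimes> Idn C (TUnit C)) = f \<cdot> RUnit C A"
    and pentagon: "\<lbrakk>A \<in> Ob C; B \<in> Ob C; D \<in> Ob C; E \<in> Ob C\<rbrakk>
      \<Longrightarrow> Assoc C A B (D \<odot> E) \<cdot> Assoc C (A \<odot> B) D E
        = (Idn C A \<boxtimes> Assoc C B D E) \<cdot> Assoc C A (B \<odot> D) E \<cdot> (Assoc C A B D \<boxtimes> Idn C E)"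
    and triangle: "\<lbrakk>A \<in> Ob C; B \<in> Ob C\<rbrakk>
      \<Longrightarrow> (Idn C A \<boxtimes> LUnit C B) \<cdot> Assoc C A (TUnit C) B = RUnit C A \<boxtimes> Idn C B"

locale abelian_tensor_category = abelian_category C + monoidal_category C
  for C :: "('o, 'a, 'm) tensor_category_scheme" (structure) +
  assumes Plus_TensArr: "\<lbrakk>f \<in> Hom C A A'; f' \<in> Hom C A A'; g \<in> Hom C B B'\<rbrakk>
      \<Longrightarrow> (f \<oplus> f') \<boxtimes> g = (f \<boxtimes> g) \<oplus> (f' \<boxtimes> g)"
    and TensArr_Plus: "\<lbrakk>f \<in> Hom C A A'; g \<in> Hom C B B'; g' \<in> Hom C B B'\<rbrakk>
      \<Longrightarrow> f \<boxtimes> (g \<oplus> g') = (f \<boxtimes> g) \<oplus> (f \<boxtimes> g')"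

text \<open>Exactness of \<open>\<otimes>\<close> means exactness in each variable.\<close>

definition tensor_exact :: "('o, 'a, 'm) tensor_category_scheme \<Rightarrow> bool" where
  "tensor_exact C \<longleftrightarrow> (\<forall>Y \<in> Ob C. \<forall>f g. short_exact C f g \<longrightarrow>
    short_exact C (f \<boxtimes>\<^bsub>C\<^esub> Idn C Y) (g \<boxtimes>\<^bsub>C\<^esub> Idn C Y) \<and>
    short_exact C (Idn C Y \<boxtimes>\<^bsub>C\<^esub> f) (Idn C Y \<boxtimes>\<^bsub>C\<^esub> g))"

text \<open>
  Given a product \<open>(P, p)\<close> of the \<open>X i\<close> and a product \<open>(Q, q)\<close> of the \<open>X i \<otimes> Y\<close>, the
  canonical morphism \<open>P \<otimes> Y \<rightarrow> Q\<close> is the unique \<open>c\<close> with \<open>q i \<cdot> c = p i \<otimes> Y\<close> for all \<open>i\<close>.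
\<close>

definition is_canonical_to_product ::
    "('o, 'a, 'm) tensor_category_scheme \<Rightarrow> 'o \<Rightarrow> ('i \<Rightarrow> 'a) \<Rightarrow> 'o \<Rightarrow> 'o \<Rightarrow> ('i \<Rightarrow> 'a)
      \<Rightarrow> 'a \<Rightarrow> bool" where
  "is_canonical_to_product C P p Y Q q c \<longleftrightarrow> c \<in> Hom C (P \<odot>\<^bsub>C\<^esub> Y) Q \<and>
    (\<forall>i. q i \<cdot>\<^bsub>C\<^esub> c = p i \<boxtimes>\<^bsub>C\<^esub> Idn C Y)"

definition countable_product_tensor_mono :: "('o, 'a, 'm) tensor_category_scheme \<Rightarrow> bool" where
  "countable_product_tensor_mono C \<longleftrightarrow>
    (\<forall>(X :: nat \<Rightarrow> 'o) Y P p Q q c. (\<forall>i. X i \<in> Ob C) \<longrightarrow> Y \<in> Ob C \<longrightarrow>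
      is_product C UNIV X P p \<longrightarrow> is_product C UNIV (\<lambda>i. X i \<odot>\<^bsub>C\<^esub> Y) Q q \<longrightarrow>
      is_canonical_to_product C P p Y Q q c \<longrightarrow> is_mono C c)"

text \<open>
  Commutation with intersections is meant in each variable: tensoring an intersection \<open>u\<close>
  of countably many subobjects \<open>m i\<close> with \<open>Y\<close>, on either side, gives an intersection of the
  \<open>m i\<close> tensored with \<open>Y\<close>.
\<close>

definition tensor_commutes_countable_intersections ::
    "('o, 'a, 'm) tensor_category_scheme \<Rightarrow> bool" where
  "tensor_commutes_countable_intersections C \<longleftrightarrow>
    (\<forall>(I :: nat set) B m u. \<forall>Y \<in> Ob C. is_intersection C B I m u \<longrightarrow>
      is_intersection C (B \<odot>\<^bsub>C\<^esub> Y) I (\<lambda>i. m i \<boxtimes>\<^bsub>C\<^esub> Idn C Y) (u \<boxtimes>\<^bsub>C\<^esub> Idn C Y) \<and>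
      is_intersection C (Y \<odot>\<^bsub>C\<^esub> B) I (\<lambda>i. Idn C Y \<boxtimes>\<^bsub>C\<^esub> m i) (Idn C Y \<boxtimes>\<^bsub>C\<^esub> u))"


section \<open>Coalgebras\<close>

record ('o, 'a) coalgebra =
  Underlying :: 'o
  Comult :: 'a
  Counit :: 'a

definition is_coalgebra ::
    "('o, 'a, 'm) tensor_category_scheme \<Rightarrow> ('o, 'a) coalgebra \<Rightarrow> bool" where
  "is_coalgebra C K \<longleftrightarrow> (let A = Underlying K; \<delta> = Comult K; \<epsilon> = Counit K in
    A \<in> Ob C \<and> \<delta> \<in> Hom C A (A \<odot>\<^bsub>C\<^esub> A) \<and> \<epsilon> \<in> Hom C A (TUnit C) \<and>
    Assoc C A A A \<cdot>\<^bsub>C\<^esub> (\<delta> \<boxtimes>\<^bsub>C\<^esub> Idn C A) \<cdot>\<^bsub>C\<^esub> \<delta> = (Idn C A \<boxtimes>\<^bsub>C\<^esub> \<delta>) \<cdot>\<^bsub>C\<^esub> \<delta> \<and>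
    LUnit C A \<cdot>\<^bsub>C\<^esub> (\<epsilon> \<boxtimes>\<^bsub>C\<^esub> Idn C A) \<cdot>\<^bsub>C\<^esub> \<delta> = Idn C A \<and>
    RUnit C A \<cdot>\<^bsub>C\<^esub> (Idn C A \<boxtimes>\<^bsub>C\<^esub> \<epsilon>) \<cdot>\<^bsub>C\<^esub> \<delta> = Idn C A)"

definition is_coalgebra_morphism ::
    "('o, 'a, 'm) tensor_category_scheme \<Rightarrow> ('o, 'a) coalgebra \<Rightarrow> ('o, 'a) coalgebra
      \<Rightarrow> 'a \<Rightarrow> bool" where
  "is_coalgebra_morphism C K L f \<longleftrightarrow> f \<in> Hom C (Underlying K) (Underlying L) \<and>
    Comult L \<cdot>\<^bsub>C\<^esub> f = (f \<boxtimes>\<^bsub>C\<^esub> f) \<cdot>\<^bsub>C\<^esub> Comult K \<and>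
    Counit L \<cdot>\<^bsub>C\<^esub> f = Counit K"

text \<open>
  A morphism of \<open>Coalg C\<close> is recorded together with its source and target coalgebra, since
  one arrow of \<open>C\<close> may be a morphism for several coalgebra structures.
\<close>

definition Coalg ::
    "('o, 'a, 'm) tensor_category_scheme
      \<Rightarrow> (('o, 'a) coalgebra, ('o, 'a) coalgebra \<times> 'a \<times> ('o, 'a) coalgebra) category" where
  "Coalg C =
    \<lparr>Ob = {K. is_coalgebra C K},
     Arr = {(K, f, L). is_coalgebra C K \<and> is_coalgebra C L \<and> is_coalgebra_morphism C K L f},
     Dom = (\<lambda>(K, f, L). K),
     Cod = (\<lambda>(K, f, L). L),
     Idn = (\<lambda>K. (K, Idn C (Underlying K), K)),
     Comp = (\<lambda>(L, g, M) (K, f, L'). (K, g \<cdot>\<^bsub>C\<^esub> f, M))\<rparr>"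

definition forgetful ::
    "(('o, 'a) coalgebra, ('o, 'a) coalgebra \<times> 'a \<times> ('o, 'a) coalgebra, 'o, 'a) cat_functor" where
  "forgetful = \<lparr>ObMap = Underlying, ArrMap = (\<lambda>(K, f, L). f)\<rparr>"

lemma (in monoidal_category) category_Coalg: "category (Coalg C)"
proof
  fix K assume "K \<in> Ob (Coalg C)"
  then have K: "is_coalgebra C K" by (simp add: Coalg_def)
  then have "is_coalgebra_morphism C K K (Idn C (Underlying K))"
    by (auto simp: is_coalgebra_morphism_def is_coalgebra_def Let_def Idn_in_Hom TensArr_Idn
        Comp_Idn Idn_Comp)
  with K show "Idn (Coalg C) K \<in> Hom (Coalg C) K K"
    by (simp add: Coalg_def Hom_def)
next
  fix f g K L M
  assume "f \<in> Hom (Coalg C) K L" "g \<in> Hom (Coalg C) L M"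
  then obtain f' g' where eq: "f = (K, f', L)" "g = (L, g', M)"
    and co: "is_coalgebra C K" "is_coalgebra C L" "is_coalgebra C M"
    and mor: "is_coalgebra_morphism C K L f'" "is_coalgebra_morphism C L M g'"
    by (auto simp: Coalg_def Hom_def)
  let ?A = "Underlying K" and ?B = "Underlying L" and ?D = "Underlying M"
  have f': "f' \<in> Hom C ?A ?B" "Comult L \<cdot> f' = (f' \<boxtimes> f') \<cdot> Comult K" "Counit L \<cdot> f' = Counit K"
    and g': "g' \<in> Hom C ?B ?D" "Comult M \<cdot> g' = (g' \<boxtimes> g') \<cdot> Comult L" "Counit M \<cdot> g' = Counit L"
    using mor by (auto simp: is_coalgebra_morphism_def)
  have cK: "Comult K \<in> Hom C ?A (?A \<odot> ?A)" and cL: "Comult L \<in> Hom C ?B (?B \<odot> ?B)"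
    and cM: "Comult M \<in> Hom C ?D (?D \<odot> ?D)" and eM: "Counit M \<in> Hom C ?D (TUnit C)"
    using co by (auto simp: is_coalgebra_def Let_def)
  have ff: "f' \<boxtimes> f' \<in> Hom C (?A \<odot> ?A) (?B \<odot> ?B)" and gg: "g' \<boxtimes> g' \<in> Hom C (?B \<odot> ?B) (?D \<odot> ?D)"
    using f' g' by (auto intro: TensArr_in_Hom)
  have "Comult M \<cdot> (g' \<cdot> f') = ((g' \<boxtimes> g') \<cdot> Comult L) \<cdot> f'"
    using Comp_assoc[OF f'(1) g'(1) cM] g'(2) by simp
  also have "\<dots> = (g' \<boxtimes> g') \<cdot> (f' \<boxtimes> f') \<cdot> Comult K"
    using Comp_assoc[OF f'(1) cL gg] f'(2) by simp
  also have "\<dots> = ((g' \<cdot> f') \<boxtimes> (g' \<cdot> f')) \<cdot> Comult K"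
    using Comp_assoc[OF cK ff gg] TensArr_Comp[OF f'(1) g'(1) f'(1) g'(1)] by simp
  finally have "is_coalgebra_morphism C K M (g' \<cdot> f')"
    using Comp_in_Hom[OF f'(1) g'(1)] Comp_assoc[OF f'(1) g'(1) eM] f'(3) g'(3)
    by (simp add: is_coalgebra_morphism_def)
  with co show "g \<cdot>\<^bsub>Coalg C\<^esub> f \<in> Hom (Coalg C) K M"
    by (simp add: eq Coalg_def Hom_def)
qed (auto simp: Coalg_def Hom_def is_coalgebra_morphism_def intro: Comp_Idn Idn_Comp Comp_assoc)

lemma (in monoidal_category) is_functor_forgetful: "is_functor (Coalg C) C forgetful"
  using category_Coalg category_axioms
  by (auto simp: is_functor_def forgetful_def Coalg_def Hom_def is_coalgebra_def
      is_coalgebra_morphism_def Let_def)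

end

theory Submission
  imports Defs "HOL-Library.Countable_Set"
begin

text \<open>
  A countable family of epimorphisms out of \<open>A\<close> is jointly monic iff its kernels intersect in zero;
  as \<open>\<otimes>\<close> is exact and commutes with countable intersections, tensoring preserves such families on
  either side. Hence, for the product \<open>P\<close> of all bracketed tensor powers of \<open>X\<close>, the object \<open>P \<otimes> P\<close>
  embeds into the product \<open>Q\<close> of the pairwise tensor products of these powers, and deconcatenation
  is a morphism \<open>D : P \<rightarrow> Q\<close>. The joint equalizer \<open>E \<le> P\<close> of the relations forced by
  coassociativity and counitality contains a largest subobject \<open>W\<close> with \<open>D(W) \<le> W \<otimes> W\<close>; it is the
  cofree coalgebra on \<open>X\<close>. A coalgebra over \<open>X\<close> maps to \<open>P\<close> by its iterated comultiplications, and
  this morphism lands in \<open>W\<close>.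
\<close>

section \<open>Right adjoints from universal arrows\<close>

text \<open>The obstacle is that \<otimes> need not commute with infinite products: splitting a
  bracketing at its root defines a morphism from \<open>P\<close> into \<open>Q\<close>, which in
  general does not lift to P \<otimes> P. Asking only that \<open>D\<close> carry \<open>W\<close>
  into P \<otimes> P would not suffice either, since both halves must be splittable again; this
  forces the self-referential condition on \<open>W\<close> and an infinite descent of preimages.
  Commutation with intersections acts twice: it keeps the intersection of the kernels zero after
  tensoring, and it makes the limit of the descent satisfy the closure condition. The projections
  have to be epimorphisms because exactness speaks of short exact sequences: the kernel of an
  epimorphism remains its kernel after tensoring. The restriction to \<open>E\<close> is needed
  because components of \<open>P\<close> at different bracketings are unrelated, whereas
  coassociativity and counitality identify some of them. Joint monicity then turns each coalgebra
  axiom into an equation between components. Uniqueness holds because a coalgebra morphism preserves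
  all iterated comultiplications, so its component at \<open>X\<close> forces the others.\<close>

lemma in_Hom_iff: "f \<in> Hom C A B \<longleftrightarrow> f \<in> Arr C \<and> Dom C f = A \<and> Cod C f = B"
  by (simp add: Hom_def)

section \<open>Typing, unit and associativity laws of composition as rewrite rules\<close>

context category
begin

lemma Comp_Arr [simp]:
  assumes "f \<in> Arr C" "g \<in> Arr C" "Cod C f = Dom C g"
  shows "g \<cdot> f \<in> Arr C" "Dom C (g \<cdot> f) = Dom C f" "Cod C (g \<cdot> f) = Cod C g"
  using Comp_in_Hom[of f "Dom C f" "Dom C g" g "Cod C g"] assms by (auto simp: in_Hom_iff)

lemma Comp_assoc_Arr [simp]:
  assumes "f \<in> Arr C" "g \<in> Arr C" "h \<in> Arr C" "Cod C f = Dom C g" "Cod C g = Dom C h"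
  shows "(h \<cdot> g) \<cdot> f = h \<cdot> g \<cdot> f"
  using Comp_assoc[of f "Dom C f" "Dom C g" g "Dom C h" h "Cod C h"] assms
  by (auto simp: in_Hom_iff)

lemma Idn_Arr [simp]:
  assumes "A \<in> Ob C"
  shows "Idn C A \<in> Arr C" "Dom C (Idn C A) = A" "Cod C (Idn C A) = A"
  using Idn_in_Hom[OF assms] by (auto simp: in_Hom_iff)

lemma Comp_Idn_Arr [simp]: "\<lbrakk>f \<in> Arr C; Dom C f = A\<rbrakk> \<Longrightarrow> f \<cdot> Idn C A = f"
  using Comp_Idn[of f A "Cod C f"] by (auto simp: in_Hom_iff)

lemma Idn_Comp_Arr [simp]: "\<lbrakk>f \<in> Arr C; Cod C f = A\<rbrakk> \<Longrightarrow> Idn C A \<cdot> f = f"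
  using Idn_Comp[of f "Dom C f" A] by (auto simp: in_Hom_iff)

lemma Dom_Cod_in_Ob [simp]:
  assumes "f \<in> Arr C"
  shows "Dom C f \<in> Ob C" "Cod C f \<in> Ob C"
  using assms Dom_in_Ob Cod_in_Ob by auto

end

text \<open>Choosing one universal arrow per object fixes the adjoint on objects; everything else is
  forced. \<open>\<phi> A X g\<close> is the unique arrow that the universal property assigns to
  \<open>g\<close>, and the adjoint sends \<open>k\<close> to the arrow assigned to \<open>k\<close>
  composed with the universal arrow.\<close>

lemma has_right_adjoint_if_universal_arrows:
  assumes F: "is_functor C D F"
    and univ: "\<And>X. X \<in> Ob D \<Longrightarrow> \<exists>K \<in> Ob C. \<exists>e \<in> Hom D (ObMap F K) X.
      \<forall>A \<in> Ob C. \<forall>g \<in> Hom D (ObMap F A) X.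
        \<exists>!h. h \<in> Hom C A K \<and> e \<cdot>\<^bsub>D\<^esub> ArrMap F h = g"
  shows "has_right_adjoint C D F"
proof -
  interpret C: category C using F by (simp add: is_functor_def)
  interpret D: category D using F by (simp add: is_functor_def)
  obtain G0 e where G0: "\<And>X. X \<in> Ob D \<Longrightarrow> G0 X \<in> Ob C"
    and e: "\<And>X. X \<in> Ob D \<Longrightarrow> e X \<in> Hom D (ObMap F (G0 X)) X"
    and u: "\<And>X A g. \<lbrakk>X \<in> Ob D; A \<in> Ob C; g \<in> Hom D (ObMap F A) X\<rbrakk>
        \<Longrightarrow> \<exists>!h. h \<in> Hom C A (G0 X) \<and> e X \<cdot>\<^bsub>D\<^esub> ArrMap F h = g"
    using univ by metis
  define \<phi> where "\<phi> A X g = (THE h. h \<in> Hom C A (G0 X) \<and> e X \<cdot>\<^bsub>D\<^esub> ArrMap F h = g)" for A X g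
  have \<phi>: "\<phi> A X g \<in> Hom C A (G0 X)" "e X \<cdot>\<^bsub>D\<^esub> ArrMap F (\<phi> A X g) = g"
    if "X \<in> Ob D" "A \<in> Ob C" "g \<in> Hom D (ObMap F A) X" for A X g
    using theI'[OF u[OF that]] by (auto simp: \<phi>_def)
  \<comment> \<open>The tool for functoriality and naturality: to identify an arrow with a value of
    \<phi>, compare the two after applying \<open>F\<close> and composing with the universal
    arrow.\<close>
  have \<phi>_eq: "\<phi> A X g = h"
    if "X \<in> Ob D" "A \<in> Ob C" "h \<in> Hom C A (G0 X)" "e X \<cdot>\<^bsub>D\<^esub> ArrMap F h = g" for A X g h
  proof -
    have "ArrMap F h \<in> Hom D (ObMap F A) (ObMap F (G0 X))"
      using F that by (auto simp: is_functor_def)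
    then have "g \<in> Hom D (ObMap F A) X" using e[OF that(1)] that by (auto intro: D.Comp_in_Hom)
    with u[OF that(1,2)] \<phi>[OF that(1,2)] that(3,4) show ?thesis by blast
  qed
  have F_Hom: "ArrMap F h \<in> Hom D (ObMap F A) (ObMap F B)" if "h \<in> Hom C A B" for h A B
    using F that by (auto simp: is_functor_def)
  have F_Comp: "ArrMap F (g \<cdot>\<^bsub>C\<^esub> f) = ArrMap F g \<cdot>\<^bsub>D\<^esub> ArrMap F f"
    if "f \<in> Hom C A B" "g \<in> Hom C B E" for f g A B E
    using F that unfolding is_functor_def by blast
  have F_Idn: "ArrMap F (Idn C A) = Idn D (ObMap F A)" "ObMap F A \<in> Ob D" if "A \<in> Ob C" for A
    using F that by (auto simp: is_functor_def)
  define G where "G = \<lparr>ObMap = G0, ArrMap = (\<lambda>k. \<phi> (G0 (Dom D k)) (Cod D k) (k \<cdot>\<^bsub>D\<^esub> e (Dom D k)))\<rparr>"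
  have G: "ArrMap G k \<in> Hom C (G0 X) (G0 X')" "e X' \<cdot>\<^bsub>D\<^esub> ArrMap F (ArrMap G k) = k \<cdot>\<^bsub>D\<^esub> e X"
    if k: "k \<in> Hom D X X'" for k X X'
  proof -
    have X: "X \<in> Ob D" "X' \<in> Ob D" and kX: "Dom D k = X" "Cod D k = X'"
      using k D.Dom_in_Ob D.Cod_in_Ob by (auto simp: in_Hom_iff)
    have "k \<cdot>\<^bsub>D\<^esub> e X \<in> Hom D (ObMap F (G0 X)) X'" using D.Comp_in_Hom[OF e[OF X(1)] k] .
    from \<phi>[OF X(2) G0[OF X(1)] this]
    show "ArrMap G k \<in> Hom C (G0 X) (G0 X')" "e X' \<cdot>\<^bsub>D\<^esub> ArrMap F (ArrMap G k) = k \<cdot>\<^bsub>D\<^esub> e X"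
      by (simp_all add: G_def kX)
  qed
  have G_eq: "ArrMap G k = h"
    if "k \<in> Hom D X X'" "h \<in> Hom C (G0 X) (G0 X')" "e X' \<cdot>\<^bsub>D\<^esub> ArrMap F h = k \<cdot>\<^bsub>D\<^esub> e X" for k h X X'
    using that \<phi>_eq[of X' "G0 X" h] G0[of X] D.Dom_in_Ob[of k] D.Cod_in_Ob[of k]
    by (auto simp: G_def in_Hom_iff)
  have G_functor: "is_functor D C G"
    unfolding is_functor_def
  proof (intro conjI ballI allI)
    show "category D" "category C" by unfold_locales
    show "ObMap G X \<in> Ob C" if "X \<in> Ob D" for X using G0[OF that] by (simp add: G_def)
    show "ArrMap G f \<in> Hom C (ObMap G A) (ObMap G B)" if "f \<in> Hom D A B" for f A B
      using G(1)[OF that] by (simp add: G_def)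
    show "ArrMap G (Idn D X) = Idn C (ObMap G X)" if X: "X \<in> Ob D" for X
      using G_eq[OF D.Idn_in_Hom[OF X] C.Idn_in_Hom[OF G0[OF X]]] G0[OF X] e[OF X]
      by (simp add: F_Idn in_Hom_iff G_def)
    show "ArrMap G (g \<cdot>\<^bsub>D\<^esub> f) = ArrMap G g \<cdot>\<^bsub>C\<^esub> ArrMap G f"
      if f: "f \<in> Hom D A B" and g: "g \<in> Hom D B E" for f g A B E
    proof (rule G_eq[OF D.Comp_in_Hom[OF f g] C.Comp_in_Hom[OF G(1)[OF f] G(1)[OF g]]])
      have Ob: "A \<in> Ob D" "B \<in> Ob D" "E \<in> Ob D"
        using f g by (auto simp: in_Hom_iff)
      note eq = D.Comp_assoc[OF F_Hom[OF G(1)[OF f]] F_Hom[OF G(1)[OF g]] e[OF Ob(3)]]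
        D.Comp_assoc[OF F_Hom[OF G(1)[OF f]] e[OF Ob(2)] g] D.Comp_assoc[OF e[OF Ob(1)] f g]
      show "e E \<cdot>\<^bsub>D\<^esub> ArrMap F (ArrMap G g \<cdot>\<^bsub>C\<^esub> ArrMap G f) = (g \<cdot>\<^bsub>D\<^esub> f) \<cdot>\<^bsub>D\<^esub> e A"
        using eq by (simp add: F_Comp[OF G(1)[OF f] G(1)[OF g]] G(2)[OF f] G(2)[OF g])
    qed
  qed
  have bij: "bij_betw (\<phi> A X) (Hom D (ObMap F A) X) (Hom C A (ObMap G X))"
    if A: "A \<in> Ob C" and X: "X \<in> Ob D" for A X
  proof (rule bij_betwI[where g = "\<lambda>h. e X \<cdot>\<^bsub>D\<^esub> ArrMap F h"])
    show "\<phi> A X \<in> Hom D (ObMap F A) X \<rightarrow> Hom C A (ObMap G X)"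
      using \<phi>(1)[OF X A] by (auto simp: G_def)
    show "(\<lambda>h. e X \<cdot>\<^bsub>D\<^esub> ArrMap F h) \<in> Hom C A (ObMap G X) \<rightarrow> Hom D (ObMap F A) X"
      using D.Comp_in_Hom[OF F_Hom e[OF X]] by (auto simp: G_def)
    show "e X \<cdot>\<^bsub>D\<^esub> ArrMap F (\<phi> A X g) = g" if "g \<in> Hom D (ObMap F A) X" for g
      using \<phi>(2)[OF X A that] .
    show "\<phi> A X (e X \<cdot>\<^bsub>D\<^esub> ArrMap F h) = h" if "h \<in> Hom C A (ObMap G X)" for h
      using \<phi>_eq[OF X A] that by (simp add: G_def)
  qed
  have nat: "\<phi> A' X' (k \<cdot>\<^bsub>D\<^esub> g \<cdot>\<^bsub>D\<^esub> ArrMap F h) = ArrMap G k \<cdot>\<^bsub>C\<^esub> \<phi> A X g \<cdot>\<^bsub>C\<^esub> h"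
    if A: "A \<in> Ob C" "A' \<in> Ob C" and X: "X \<in> Ob D" "X' \<in> Ob D"
      and h: "h \<in> Hom C A' A" and k: "k \<in> Hom D X X'" and g: "g \<in> Hom D (ObMap F A) X"
    for A A' X X' h k g
  proof (rule \<phi>_eq[OF X(2) A(2)])
    note \<phi>g = \<phi>[OF X(1) A(1) g]
    have \<phi>h: "\<phi> A X g \<cdot>\<^bsub>C\<^esub> h \<in> Hom C A' (G0 X)" using C.Comp_in_Hom[OF h \<phi>g(1)] .
    show "ArrMap G k \<cdot>\<^bsub>C\<^esub> \<phi> A X g \<cdot>\<^bsub>C\<^esub> h \<in> Hom C A' (G0 X')"
      using C.Comp_in_Hom[OF \<phi>h G(1)[OF k]] .
    have "e X' \<cdot>\<^bsub>D\<^esub> ArrMap F (ArrMap G k \<cdot>\<^bsub>C\<^esub> \<phi> A X g \<cdot>\<^bsub>C\<^esub> h)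
        = (e X' \<cdot>\<^bsub>D\<^esub> ArrMap F (ArrMap G k)) \<cdot>\<^bsub>D\<^esub> ArrMap F (\<phi> A X g) \<cdot>\<^bsub>D\<^esub> ArrMap F h"
      using F_Hom[OF h] F_Hom[OF \<phi>g(1)] F_Hom[OF G(1)[OF k]] e[OF X(2)]
      by (simp add: F_Comp[OF \<phi>h G(1)[OF k]] F_Comp[OF h \<phi>g(1)] in_Hom_iff)
    also have "\<dots> = k \<cdot>\<^bsub>D\<^esub> (e X \<cdot>\<^bsub>D\<^esub> ArrMap F (\<phi> A X g)) \<cdot>\<^bsub>D\<^esub> ArrMap F h"
      using F_Hom[OF h] F_Hom[OF \<phi>g(1)] e[OF X(1)] k
      by (simp add: G(2)[OF k] in_Hom_iff del: \<phi>g)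
    finally show "e X' \<cdot>\<^bsub>D\<^esub> ArrMap F (ArrMap G k \<cdot>\<^bsub>C\<^esub> \<phi> A X g \<cdot>\<^bsub>C\<^esub> h) = k \<cdot>\<^bsub>D\<^esub> g \<cdot>\<^bsub>D\<^esub> ArrMap F h"
      by (simp add: \<phi>g(2))
  qed
  have "is_adjunction C D F G \<phi>"
    unfolding is_adjunction_def using F G_functor bij nat by blast
  then show ?thesis unfolding has_right_adjoint_def by blast
qed


section \<open>Kernels, intersections and equalizers\<close>

text \<open>The index ranges over a whole type, so countability becomes a type class constraint and
  families indexed by pairs or triples of bracketings need no index sets.\<close>

definition jointly_monic ::
    "('o, 'a, 'm) category_scheme \<Rightarrow> 'o \<Rightarrow> ('i \<Rightarrow> 'a) \<Rightarrow> bool" where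
  "jointly_monic C A u \<longleftrightarrow> (\<forall>i. u i \<in> Arr C \<and> Dom C (u i) = A) \<and>
    (\<forall>f \<in> Arr C. \<forall>g \<in> Arr C. Cod C f = A \<longrightarrow> Cod C g = A \<longrightarrow> Dom C f = Dom C g \<longrightarrow>
      (\<forall>i. u i \<cdot>\<^bsub>C\<^esub> f = u i \<cdot>\<^bsub>C\<^esub> g) \<longrightarrow> f = g)"

section \<open>Monomorphisms, factorization and countable products in an arbitrary category\<close>

context category
begin

lemma is_monoI:
  assumes "m \<in> Arr C"
    and "\<And>f g. \<lbrakk>f \<in> Arr C; g \<in> Arr C; Cod C f = Dom C m; Cod C g = Dom C m; Dom C f = Dom C g;
      m \<cdot> f = m \<cdot> g\<rbrakk> \<Longrightarrow> f = g"
  shows "is_mono C m"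
  using assms by (auto simp: is_mono_def in_Hom_iff)

lemma is_mono_cancel:
  "\<lbrakk>is_mono C m; f \<in> Arr C; g \<in> Arr C; Cod C f = Dom C m; Cod C g = Dom C m; Dom C f = Dom C g;
    m \<cdot> f = m \<cdot> g\<rbrakk> \<Longrightarrow> f = g"
  unfolding is_mono_def using Dom_in_Ob by (metis in_Hom_iff)

lemma is_epi_cancel:
  "\<lbrakk>is_epi C e; f \<in> Arr C; g \<in> Arr C; Dom C f = Cod C e; Dom C g = Cod C e; Cod C f = Cod C g;
    f \<cdot> e = g \<cdot> e\<rbrakk> \<Longrightarrow> f = g"
  unfolding is_epi_def using Cod_in_Ob by (metis in_Hom_iff)

lemma is_mono_Comp:
  assumes "is_mono C m" "is_mono C n" "Cod C n = Dom C m"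
  shows "is_mono C (m \<cdot> n)"
proof (rule is_monoI)
  have [simp]: "m \<in> Arr C" "n \<in> Arr C" using assms by (auto simp: is_mono_def)
  show "m \<cdot> n \<in> Arr C" using assms(3) by simp
  fix f g
  assume *: "f \<in> Arr C" "g \<in> Arr C" "Cod C f = Dom C (m \<cdot> n)" "Cod C g = Dom C (m \<cdot> n)"
    "Dom C f = Dom C g" "(m \<cdot> n) \<cdot> f = (m \<cdot> n) \<cdot> g"
  have "n \<cdot> f = n \<cdot> g"
    by (rule is_mono_cancel[OF assms(1)]) (use * assms(3) in simp_all)
  then show "f = g"
    by (intro is_mono_cancel[OF assms(2), of f g]) (use * assms(3) in simp_all)
qed

lemma is_epi_Comp:
  assumes "is_epi C e" "is_epi C e'" "Cod C e = Dom C e'"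
  shows "is_epi C (e' \<cdot> e)"
proof -
  have [simp]: "e \<in> Arr C" "e' \<in> Arr C" using assms by (auto simp: is_epi_def)
  have "f = g" if *: "f \<in> Arr C" "g \<in> Arr C" "Dom C f = Cod C e'" "Dom C g = Cod C e'"
    "Cod C f = Cod C g" "f \<cdot> e' \<cdot> e = g \<cdot> e' \<cdot> e" for f g
  proof -
    have "f \<cdot> e' = g \<cdot> e'"
      by (rule is_epi_cancel[OF assms(1)]) (use * assms(3) in simp_all)
    then show ?thesis
      by (intro is_epi_cancel[OF assms(2), of f g]) (use * assms(3) in simp_all)
  qed
  then show ?thesis using assms(3) by (auto simp: is_epi_def in_Hom_iff)
qed

lemma is_mono_Idn: "A \<in> Ob C \<Longrightarrow> is_mono C (Idn C A)"
  by (auto intro: is_monoI)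

lemma factors_through_iff:
  "factors_through C f m \<longleftrightarrow> (\<exists>h \<in> Arr C. Dom C h = Dom C f \<and> Cod C h = Dom C m \<and> f = m \<cdot> h)"
  by (auto simp: factors_through_def in_Hom_iff)

lemma factors_throughI:
  "\<lbrakk>h \<in> Arr C; Dom C h = Dom C f; Cod C h = Dom C m; f = m \<cdot> h\<rbrakk> \<Longrightarrow> factors_through C f m"
  unfolding factors_through_iff by blast

lemma factors_through_trans:
  assumes "factors_through C f g" "factors_through C g h" "h \<in> Arr C"
  shows "factors_through C f h"
proof -
  obtain k l where k: "k \<in> Arr C" "Dom C k = Dom C f" "Cod C k = Dom C g" "f = g \<cdot> k"
    and l: "l \<in> Arr C" "Dom C l = Dom C g" "Cod C l = Dom C h" "g = h \<cdot> l"
    using assms(1,2) unfolding factors_through_iff by blast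
  show ?thesis
  proof (rule factors_throughI[of "l \<cdot> k"])
    have "f = (h \<cdot> l) \<cdot> k" using k(4) l(4) by metis
    then show "f = h \<cdot> l \<cdot> k" using k(1,3) l(1-3) assms(3) by simp
  qed (use k(1-3) l(1-3) in simp_all)
qed

lemma factors_through_Comp:
  assumes "factors_through C f g" "g \<in> Arr C" "m \<in> Arr C" "Cod C g = Dom C m"
  shows "factors_through C (m \<cdot> f) (m \<cdot> g)"
proof -
  obtain k where k: "k \<in> Arr C" "Dom C k = Dom C f" "Cod C k = Dom C g" "f = g \<cdot> k"
    using assms(1) unfolding factors_through_iff by blast
  show ?thesis
    unfolding k(4) by (rule factors_throughI[of k]) (use k(1,3) assms(2-4) in simp_all)
qed

lemma jointly_monic_cancel:
  "\<lbrakk>jointly_monic C A u; f \<in> Arr C; g \<in> Arr C; Cod C f = A; Cod C g = A; Dom C f = Dom C g;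
    \<And>i. u i \<cdot> f = u i \<cdot> g\<rbrakk> \<Longrightarrow> f = g"
  unfolding jointly_monic_def by blast

lemma jointly_monic_Comp_mono:
  assumes "jointly_monic C A u" "is_mono C m" "Cod C m = A"
  shows "jointly_monic C (Dom C m) (\<lambda>i. u i \<cdot> m)"
proof -
  have [simp]: "m \<in> Arr C" "u i \<in> Arr C" "Dom C (u i) = A" for i
    using assms by (auto simp: is_mono_def jointly_monic_def)
  have "f = g" if *: "f \<in> Arr C" "g \<in> Arr C" "Cod C f = Dom C m" "Cod C g = Dom C m"
    "Dom C f = Dom C g" "\<And>i. u i \<cdot> m \<cdot> f = u i \<cdot> m \<cdot> g" for f g
  proof -
    have "m \<cdot> f = m \<cdot> g"
      by (rule jointly_monic_cancel[OF assms(1)]) (use * assms(3) in simp_all)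
    then show ?thesis
      by (intro is_mono_cancel[OF assms(2), of f g]) (use * in simp_all)
  qed
  then show ?thesis using assms(3) by (auto simp: jointly_monic_def)
qed

lemma product_projection:
  assumes "is_product C UNIV X P p"
  shows "P \<in> Ob C" "p i \<in> Arr C" "Dom C (p i) = P" "Cod C (p i) = X i"
  using assms by (auto simp: is_product_def in_Hom_iff)

lemma product_ex1:
  assumes "is_product C I X P p" "A \<in> Ob C" "\<And>i. i \<in> I \<Longrightarrow> f i \<in> Hom C A (X i)"
  shows "\<exists>!h. h \<in> Hom C A P \<and> (\<forall>i \<in> I. p i \<cdot> h = f i)"
  using assms by (simp add: is_product_def)

lemma product_lift:
  assumes "is_product C UNIV X P p" "A \<in> Ob C"
    and "\<And>i. f i \<in> Arr C" "\<And>i. Dom C (f i) = A" "\<And>i. Cod C (f i) = X i"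
  shows "\<exists>h \<in> Arr C. Dom C h = A \<and> Cod C h = P \<and> (\<forall>i. p i \<cdot> h = f i)"
proof -
  have "f i \<in> Hom C A (X i)" for i using assms(3-5) by (simp add: in_Hom_iff)
  from product_ex1[OF assms(1,2) this] show ?thesis by (auto simp: in_Hom_iff)
qed

lemma product_jointly_monic:
  assumes "is_product C UNIV X P p"
  shows "jointly_monic C P p"
  unfolding jointly_monic_def
proof (intro conjI allI ballI impI)
  note p = product_projection[OF assms]
  fix i show "p i \<in> Arr C" "Dom C (p i) = P" using p by auto
next
  note p = product_projection[OF assms]
  fix f g
  assume *: "f \<in> Arr C" "g \<in> Arr C" "Cod C f = P" "Cod C g = P" "Dom C f = Dom C g"
    "\<forall>i. p i \<cdot> f = p i \<cdot> g"
  have "p i \<cdot> g \<in> Hom C (Dom C g) (X i)" for i using * p by (simp add: in_Hom_iff)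
  from product_ex1[OF assms Dom_in_Ob[OF *(2)] this]
  have "\<exists>!h. h \<in> Hom C (Dom C g) P \<and> (\<forall>i \<in> UNIV. p i \<cdot> h = p i \<cdot> g)" .
  moreover have "f \<in> Hom C (Dom C g) P" "g \<in> Hom C (Dom C g) P" using * by (auto simp: in_Hom_iff)
  ultimately show "f = g" using *(6) by blast
qed

text \<open>Transports products over sets of natural numbers along \<open>to_nat\<close>, so that
  bracketings and pairs of bracketings can serve as indices.\<close>

lemma ex_countable_product:
  fixes X :: "'i::countable \<Rightarrow> 'o"
  assumes "has_countable_products C" "\<And>i. X i \<in> Ob C"
  shows "\<exists>P p. is_product C UNIV X P p"
proof -
  let ?I = "range (to_nat :: 'i \<Rightarrow> nat)"
  have "\<forall>i \<in> ?I. X (from_nat i) \<in> Ob C" using assms(2) by simp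
  then obtain P p where P: "is_product C ?I (\<lambda>i. X (from_nat i)) P p"
    using assms(1) unfolding has_countable_products_def by meson
  have "is_product C UNIV X P (\<lambda>i. p (to_nat i))"
    unfolding is_product_def
  proof (intro conjI ballI allI impI)
    show "P \<in> Ob C" "p (to_nat i) \<in> Hom C P (X i)" for i
      using P by (auto simp: is_product_def)
    fix A f assume A: "A \<in> Ob C" and f: "\<forall>i \<in> UNIV. f i \<in> Hom C A (X i)"
    have "f (from_nat j) \<in> Hom C A (X (from_nat j))" for j using f by simp
    from product_ex1[OF P A this] show "\<exists>!h. h \<in> Hom C A P \<and> (\<forall>i \<in> UNIV. p (to_nat i) \<cdot> h = f i)" by simp
  qed
  then show ?thesis by blast
qed

end

section \<open>Differences, kernels and cokernels in a preadditive category\<close>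

context preadditive_category
begin

lemma Zero_Arr [simp]:
  assumes "A \<in> Ob C" "B \<in> Ob C"
  shows "Zero C A B \<in> Arr C" "Dom C (Zero C A B) = A" "Cod C (Zero C A B) = B"
proof -
  interpret comm_group "Hom_group C A B" using Hom_comm_group[OF assms] .
  show "Zero C A B \<in> Arr C" "Dom C (Zero C A B) = A" "Cod C (Zero C A B) = B"
    using one_closed by (auto simp: Hom_group_def in_Hom_iff)
qed

lemma Plus_Zero:
  assumes "f \<in> Hom C A B"
  shows "Zero C A B \<oplus> f = f"
proof -
  have "A \<in> Ob C" "B \<in> Ob C" using assms Dom_in_Ob Cod_in_Ob by (auto simp: in_Hom_iff)
  then interpret comm_group "Hom_group C A B" by (rule Hom_comm_group)
  show ?thesis using l_one[of f] assms by (simp add: Hom_group_def)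
qed

lemma Plus_eq_right_iff:
  assumes "d \<in> Hom C A B" "f \<in> Hom C A B"
  shows "d \<oplus> f = f \<longleftrightarrow> d = Zero C A B"
proof -
  have "A \<in> Ob C" "B \<in> Ob C" using assms Dom_in_Ob Cod_in_Ob by (auto simp: in_Hom_iff)
  then interpret comm_group "Hom_group C A B" by (rule Hom_comm_group)
  show ?thesis
    using right_cancel[of f d "Zero C A B"] one_closed assms Plus_Zero[OF assms(2)]
    by (simp add: Hom_group_def)
qed

text \<open>Replaces subtraction, for which the record of a preadditive category has no operation;
  the witness is built with the inverse of the group of morphisms.\<close>

lemma ex_difference:
  assumes "f \<in> Hom C A B" "g \<in> Hom C A B"
  shows "\<exists>d \<in> Hom C A B. f = d \<oplus> g"
proof -
  have "A \<in> Ob C" "B \<in> Ob C" using assms Dom_in_Ob Cod_in_Ob by (auto simp: in_Hom_iff)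
  then interpret G: comm_group "Hom_group C A B" by (rule Hom_comm_group)
  let ?d = "f \<otimes>\<^bsub>Hom_group C A B\<^esub> inv\<^bsub>Hom_group C A B\<^esub> g"
  have fg: "f \<in> carrier (Hom_group C A B)" "g \<in> carrier (Hom_group C A B)"
    using assms by (simp_all add: Hom_group_def)
  then have "?d \<in> carrier (Hom_group C A B)" "f = ?d \<otimes>\<^bsub>Hom_group C A B\<^esub> g"
    by (simp_all add: G.m_assoc)
  then show ?thesis by (auto simp: Hom_group_def)
qed

lemma Comp_Zero [simp]:
  assumes "g \<in> Arr C" "A \<in> Ob C" "Dom C g = B"
  shows "g \<cdot> Zero C A B = Zero C A (Cod C g)"
proof -
  have Z: "Zero C A B \<in> Hom C A B" "g \<in> Hom C B (Cod C g)" using assms by (auto simp: in_Hom_iff)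
  have "(g \<cdot> Zero C A B) \<oplus> (g \<cdot> Zero C A B) = g \<cdot> Zero C A B"
    using Comp_Plus[OF Z(1) Z(1) Z(2)] Plus_Zero[OF Z(1)] by simp
  then show ?thesis using Plus_eq_right_iff Comp_in_Hom[OF Z] by blast
qed

lemma Zero_Comp [simp]:
  assumes "f \<in> Arr C" "B \<in> Ob C" "Cod C f = A"
  shows "Zero C A B \<cdot> f = Zero C (Dom C f) B"
proof -
  have Z: "Zero C A B \<in> Hom C A B" "f \<in> Hom C (Dom C f) A" using assms by (auto simp: in_Hom_iff)
  have "(Zero C A B \<cdot> f) \<oplus> (Zero C A B \<cdot> f) = Zero C A B \<cdot> f"
    using Plus_Comp[OF Z(2) Z(1) Z(1)] Plus_Zero[OF Z(1)] by simp
  then show ?thesis using Plus_eq_right_iff Comp_in_Hom[OF Z(2,1)] by blast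
qed

text \<open>By additivity it is enough to test against zero: if \<open>f\<close> and
  \<open>g\<close> agree after every \<open>u i\<close>, then their difference is killed by every
  \<open>u i\<close>.\<close>

lemma jointly_monicI:
  assumes u: "\<And>i. u i \<in> Arr C" "\<And>i. Dom C (u i) = A"
    and zero: "\<And>f. \<lbrakk>f \<in> Arr C; Cod C f = A; \<And>i. u i \<cdot> f = Zero C (Dom C f) (Cod C (u i))\<rbrakk>
      \<Longrightarrow> f = Zero C (Dom C f) A"
  shows "jointly_monic C A u"
  unfolding jointly_monic_def
proof (intro conjI allI ballI impI)
  fix f g
  assume *: "f \<in> Arr C" "g \<in> Arr C" "Cod C f = A" "Cod C g = A" "Dom C f = Dom C g"
    "\<forall>i. u i \<cdot> f = u i \<cdot> g"
  let ?B = "Dom C f"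
  have fg: "f \<in> Hom C ?B A" "g \<in> Hom C ?B A" using * by (auto simp: in_Hom_iff)
  then obtain d where d: "d \<in> Hom C ?B A" "f = d \<oplus> g" using ex_difference by blast
  have "u i \<cdot> d = Zero C ?B (Cod C (u i))" for i
  proof -
    have ui: "u i \<in> Hom C A (Cod C (u i))" using u by (simp add: in_Hom_iff)
    have "(u i \<cdot> d) \<oplus> (u i \<cdot> g) = u i \<cdot> g"
      using Comp_Plus[OF d(1) fg(2) ui] *(6) d(2) by metis
    then show ?thesis
      using Plus_eq_right_iff[OF Comp_in_Hom[OF d(1) ui] Comp_in_Hom[OF fg(2) ui]] by simp
  qed
  then have "d = Zero C ?B A" using zero[of d] d(1) by (auto simp: in_Hom_iff)
  then show "f = g" using d(2) Plus_Zero[OF fg(2)] by simp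
qed (use u in simp_all)

text \<open>The witness is the difference of \<open>f\<close> and \<open>g\<close>. Stating the
  equivalence for each test arrow \<open>h\<close> allows many such pairs to be collected into one
  kernel.\<close>

lemma equalizer_as_kernel:
  assumes "f \<in> Arr C" "g \<in> Arr C" "Dom C f = Dom C g" "Cod C f = Cod C g"
  shows "\<exists>d \<in> Arr C. Dom C d = Dom C f \<and> Cod C d = Cod C f \<and>
    (\<forall>h \<in> Arr C. Cod C h = Dom C f \<longrightarrow>
      (f \<cdot> h = g \<cdot> h \<longleftrightarrow> d \<cdot> h = Zero C (Dom C h) (Cod C f)))"
proof -
  let ?A = "Dom C f" and ?B = "Cod C f"
  have fg: "f \<in> Hom C ?A ?B" "g \<in> Hom C ?A ?B" using assms by (auto simp: in_Hom_iff)
  then obtain d where d: "d \<in> Hom C ?A ?B" "f = d \<oplus> g" using ex_difference by blast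
  have "f \<cdot> h = g \<cdot> h \<longleftrightarrow> d \<cdot> h = Zero C (Dom C h) (Cod C f)"
    if "h \<in> Arr C" "Cod C h = Dom C f" for h
  proof -
    have h: "h \<in> Hom C (Dom C h) ?A" using that by (simp add: in_Hom_iff)
    show ?thesis
      using Plus_Comp[OF h d(1) fg(2)] d(2)
        Plus_eq_right_iff[OF Comp_in_Hom[OF h d(1)] Comp_in_Hom[OF h fg(2)]] by simp
  qed
  then show ?thesis using d(1) by (auto simp: in_Hom_iff)
qed

lemma is_kernel_ex1:
  assumes "is_kernel C k f" "g \<in> Arr C" "Cod C g = Dom C f" "f \<cdot> g = Zero C (Dom C g) (Cod C f)"
  shows "\<exists>!h. h \<in> Hom C (Dom C g) (Dom C k) \<and> k \<cdot> h = g"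
  using assms by (simp add: is_kernel_def in_Hom_iff)

lemma is_cokernel_ex1:
  assumes "is_cokernel C c f" "g \<in> Arr C" "Dom C g = Cod C f" "g \<cdot> f = Zero C (Dom C f) (Cod C g)"
  shows "\<exists>!h. h \<in> Hom C (Cod C c) (Cod C g) \<and> h \<cdot> c = g"
  using assms by (simp add: is_cokernel_def in_Hom_iff)

text \<open>The last clause is the working form of kernels below: containment in a subobject becomes
  the vanishing of a composite.\<close>

lemma is_kernelD:
  assumes "is_kernel C k f"
  shows "is_mono C k" "k \<in> Arr C" "f \<in> Arr C" "Cod C k = Dom C f"
    "f \<cdot> k = Zero C (Dom C k) (Cod C f)"
    "\<And>h. \<lbrakk>h \<in> Arr C; Cod C h = Dom C f\<rbrakk> \<Longrightarrow>
      factors_through C h k \<longleftrightarrow> f \<cdot> h = Zero C (Dom C h) (Cod C f)"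
proof -
  show k: "k \<in> Arr C" "f \<in> Arr C" "Cod C k = Dom C f" "f \<cdot> k = Zero C (Dom C k) (Cod C f)"
    using assms by (auto simp: is_kernel_def)
  note ex1 = is_kernel_ex1[OF assms]
  show "factors_through C h k \<longleftrightarrow> f \<cdot> h = Zero C (Dom C h) (Cod C f)"
    if h: "h \<in> Arr C" "Cod C h = Dom C f" for h
  proof
    assume "factors_through C h k"
    then obtain l where l: "l \<in> Arr C" "Dom C l = Dom C h" "Cod C l = Dom C k" "h = k \<cdot> l"
      by (auto simp: factors_through_iff)
    have "f \<cdot> h = (f \<cdot> k) \<cdot> l" using l k(1-3) by simp
    also have "\<dots> = Zero C (Dom C h) (Cod C f)" unfolding k(4) using l k(1-3) by simp
    finally show "f \<cdot> h = Zero C (Dom C h) (Cod C f)" .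
  next
    assume "f \<cdot> h = Zero C (Dom C h) (Cod C f)"
    then show "factors_through C h k" using ex1[OF h] by (auto simp: factors_through_def)
  qed
  show "is_mono C k"
  proof (rule is_monoI[OF k(1)])
    fix g h
    assume *: "g \<in> Arr C" "h \<in> Arr C" "Cod C g = Dom C k" "Cod C h = Dom C k" "Dom C g = Dom C h"
      "k \<cdot> g = k \<cdot> h"
    have "f \<cdot> k \<cdot> g = (f \<cdot> k) \<cdot> g" using * k(1-3) by simp
    also have "\<dots> = Zero C (Dom C g) (Cod C f)" unfolding k(4) using * k(1-3) by simp
    finally have "\<exists>!l. l \<in> Hom C (Dom C g) (Dom C k) \<and> k \<cdot> l = k \<cdot> g"
      using ex1[of "k \<cdot> g"] * k(1-3) by simp
    moreover have "g \<in> Hom C (Dom C g) (Dom C k)" "h \<in> Hom C (Dom C g) (Dom C k)"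
      using * by (auto simp: in_Hom_iff)
    ultimately show "g = h" using *(6) by metis
  qed
qed

lemma is_cokernel_epi:
  assumes "is_cokernel C c f"
  shows "is_epi C c"
proof -
  have c: "c \<in> Arr C" "f \<in> Arr C" "Dom C c = Cod C f" "c \<cdot> f = Zero C (Dom C f) (Cod C c)"
    using assms by (auto simp: is_cokernel_def)
  have "g = h" if *: "g \<in> Arr C" "h \<in> Arr C" "Dom C g = Cod C c" "Dom C h = Cod C c"
    "Cod C g = Cod C h" "g \<cdot> c = h \<cdot> c" for g h
  proof -
    have "(g \<cdot> c) \<cdot> f = g \<cdot> c \<cdot> f" using * c(1-3) by (intro Comp_assoc_Arr) auto
    also have "\<dots> = Zero C (Dom C f) (Cod C g)" unfolding c(4) using * c(1-3) by simp
    finally have "\<exists>!l. l \<in> Hom C (Cod C c) (Cod C g) \<and> l \<cdot> c = g \<cdot> c"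
      using is_cokernel_ex1[OF assms, of "g \<cdot> c"] * c(1-3) by simp
    moreover have "g \<in> Hom C (Cod C c) (Cod C g)" "h \<in> Hom C (Cod C c) (Cod C g)"
      using * by (auto simp: in_Hom_iff)
    ultimately show "g = h" using *(6) by metis
  qed
  then show ?thesis using c(1) by (auto simp: is_epi_def in_Hom_iff)
qed

lemma product_projection_epi:
  assumes P: "is_product C UNIV X P p"
  shows "is_epi C (p i)"
proof -
  note p = product_projection[OF P]
  have X: "X j \<in> Ob C" for j using p(2)[of j] p(4)[of j] by (metis Cod_in_Ob)
  \<comment> \<open>A section of the \<open>i\<close>-th projection: the identity in component
    \<open>i\<close>, zero morphisms elsewhere. A split projection is an epimorphism.\<close>
  have "\<exists>s \<in> Arr C. Dom C s = X i \<and> Cod C s = P \<and>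
      (\<forall>j. p j \<cdot> s = (if j = i then Idn C (X i) else Zero C (X i) (X j)))"
    using X by (intro product_lift[OF P]) auto
  then obtain s where s: "s \<in> Arr C" "Dom C s = X i" "Cod C s = P" "p i \<cdot> s = Idn C (X i)"
    by auto
  have "f = g" if *: "f \<in> Arr C" "g \<in> Arr C" "Dom C f = X i" "Dom C g = X i" "f \<cdot> p i = g \<cdot> p i"
    for f g
  proof -
    have "(f \<cdot> p i) \<cdot> s = f" "(g \<cdot> p i) \<cdot> s = g" using *(1-4) s p by simp_all
    then show ?thesis using *(5) by metis
  qed
  then show ?thesis using p by (auto simp: is_epi_def in_Hom_iff)
qed

end

section \<open>Short exact sequences, preimages, equalizers and intersections in an abelian
  category\<close>

context abelian_category
begin

text \<open>Normality presents \<open>e\<close> as the cokernel of some \<open>f\<close>. Since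
  \<open>f\<close> factors through the kernel \<open>k\<close> of \<open>e\<close>, every arrow that
  kills \<open>k\<close> also kills \<open>f\<close>, so \<open>e\<close> is the cokernel of
  \<open>k\<close> as well.\<close>

lemma short_exact_kernel:
  assumes "is_epi C e"
  shows "\<exists>k. short_exact C k e"
proof -
  obtain f where f: "is_cokernel C e f" using epi_normal[OF assms] by blast
  have e: "e \<in> Arr C" "f \<in> Arr C" "Dom C e = Cod C f" "e \<cdot> f = Zero C (Dom C f) (Cod C e)"
    using f by (auto simp: is_cokernel_def)
  obtain k where k: "is_kernel C k e" using ex_kernel e by blast
  note kD = is_kernelD[OF k]
  obtain l where l: "l \<in> Arr C" "Dom C l = Dom C f" "Cod C l = Dom C k" "f = k \<cdot> l"
    using kD(6)[of f] e by (auto simp: factors_through_iff)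
  have "\<exists>!h. h \<in> Hom C (Cod C e) B \<and> h \<cdot> e = g"
    if "g \<in> Hom C (Cod C k) B" "g \<cdot> k = Zero C (Dom C k) B" for g B
  proof -
    have g: "g \<in> Arr C" "Dom C g = Cod C k" "Cod C g = B" using that by (auto simp: in_Hom_iff)
    have "g \<cdot> f = (g \<cdot> k) \<cdot> l" using l g kD by simp
    also have "\<dots> = Zero C (Dom C f) B" unfolding that(2) using l g kD by auto
    finally show ?thesis using is_cokernel_ex1[OF f, of g] g e(3) kD(4) by simp
  qed
  then have "is_cokernel C e k" using kD by (simp add: is_cokernel_def)
  then show ?thesis using k by (auto simp: short_exact_def)
qed

text \<open>Dual argument: if \<open>m\<close> is the kernel of \<open>f\<close>, then
  \<open>f\<close> factors through the cokernel \<open>c\<close> of \<open>m\<close>, so every arrow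
  killed by \<open>c\<close> is killed by \<open>f\<close>.\<close>

lemma short_exact_cokernel:
  assumes "is_mono C m"
  shows "\<exists>c. short_exact C m c"
proof -
  obtain f where f: "is_kernel C m f" using mono_normal[OF assms] by blast
  note fD = is_kernelD[OF f]
  obtain c where c: "is_cokernel C c m" using ex_cokernel fD by blast
  have cD: "c \<in> Arr C" "Dom C c = Cod C m" "c \<cdot> m = Zero C (Dom C m) (Cod C c)"
    using c by (auto simp: is_cokernel_def)
  have "\<exists>!l. l \<in> Hom C (Cod C c) (Cod C f) \<and> l \<cdot> c = f"
    using is_cokernel_ex1[OF c, of f] fD by simp
  then obtain l where l: "l \<in> Arr C" "Dom C l = Cod C c" "Cod C l = Cod C f" "l \<cdot> c = f"
    by (auto simp: in_Hom_iff)
  have "\<exists>!h. h \<in> Hom C A (Dom C m) \<and> m \<cdot> h = g"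
    if "g \<in> Hom C A (Dom C c)" "c \<cdot> g = Zero C A (Cod C c)" for g A
  proof -
    have g: "g \<in> Arr C" "Cod C g = Dom C c" "Dom C g = A" using that by (auto simp: in_Hom_iff)
    have "f \<cdot> g = l \<cdot> c \<cdot> g" using l g cD by auto
    also have "\<dots> = Zero C A (Cod C f)" unfolding that(2) using l g cD by auto
    finally show ?thesis using is_kernel_ex1[OF f, of g] g fD(4) cD(2) by simp
  qed
  then have "is_kernel C m c" using fD cD by (simp add: is_kernel_def)
  then show ?thesis using c by (auto simp: short_exact_def)
qed

text \<open>The preimage of a subobject along \<open>D\<close>: if \<open>m\<close> is the kernel of
  \<open>f\<close>, its preimage is the kernel of \<open>f \<cdot> D\<close>.\<close>

lemma ex_mono_pullback:
  assumes "D \<in> Arr C" "is_mono C m" "Cod C m = Cod C D"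
  shows "\<exists>m'. is_mono C m' \<and> Cod C m' = Dom C D \<and>
    (\<forall>h \<in> Arr C. Cod C h = Dom C D \<longrightarrow> (factors_through C h m' \<longleftrightarrow> factors_through C (D \<cdot> h) m))"
proof -
  obtain f where "is_kernel C m f" using mono_normal[OF assms(2)] by blast
  note f = is_kernelD[OF this]
  obtain m' where "is_kernel C m' (f \<cdot> D)" using ex_kernel[of "f \<cdot> D"] f assms by auto
  note m' = is_kernelD[OF this]
  have "factors_through C h m' \<longleftrightarrow> factors_through C (D \<cdot> h) m"
    if "h \<in> Arr C" "Cod C h = Dom C D" for h
    using m'(6)[of h] f(6)[of "D \<cdot> h"] that f(3,4) assms by simp
  then show ?thesis using m' f assms by auto
qed

text \<open>Each pair contributes its difference; the differences are the components of a single
  morphism \<open>t\<close> into a countable product, and the kernel of \<open>t\<close> is the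
  joint equalizer.\<close>

lemma ex_joint_equalizer:
  assumes prod: "has_countable_products C" and "countable S" and A: "A \<in> Ob C"
    and S: "\<And>f g. (f, g) \<in> S \<Longrightarrow> f \<in> Arr C \<and> g \<in> Arr C \<and> Dom C f = A \<and> Dom C g = A \<and> Cod C f = Cod C g"
  shows "\<exists>e. is_mono C e \<and> Cod C e = A \<and>
    (\<forall>h \<in> Arr C. Cod C h = A \<longrightarrow> (factors_through C h e \<longleftrightarrow> (\<forall>(f, g) \<in> S. f \<cdot> h = g \<cdot> h)))"
proof -
  \<comment> \<open>The trivial pair imposes no condition but makes the set nonempty, so that
    \<open>from_nat_into\<close> enumerates it exactly even when \<open>S\<close> is empty.\<close>
  define S' where "S' = insert (Idn C A, Idn C A) S"
  define f g where "f n = fst (from_nat_into S' n)" and "g n = snd (from_nat_into S' n)" for n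
  have range: "range (from_nat_into S') = S'"
    using assms(2) by (intro range_from_nat_into) (auto simp: S'_def)
  have fg: "f n \<in> Arr C \<and> g n \<in> Arr C \<and> Dom C (f n) = A \<and> Dom C (g n) = A \<and> Cod C (f n) = Cod C (g n)"
    for n
  proof -
    have "(f n, g n) \<in> S'" using from_nat_into[of S' n] by (simp add: f_def g_def S'_def)
    then show ?thesis using S A by (auto simp: S'_def)
  qed
  have "\<forall>n. \<exists>d \<in> Arr C. Dom C d = A \<and> Cod C d = Cod C (f n) \<and>
    (\<forall>h \<in> Arr C. Cod C h = A \<longrightarrow>
      (f n \<cdot> h = g n \<cdot> h \<longleftrightarrow> d \<cdot> h = Zero C (Dom C h) (Cod C (f n))))"
    using equalizer_as_kernel fg by metis
  then obtain d where d: "\<And>n. d n \<in> Arr C" "\<And>n. Dom C (d n) = A" "\<And>n. Cod C (d n) = Cod C (f n)"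
    and d_iff: "\<And>n h. \<lbrakk>h \<in> Arr C; Cod C h = A\<rbrakk> \<Longrightarrow>
      f n \<cdot> h = g n \<cdot> h \<longleftrightarrow> d n \<cdot> h = Zero C (Dom C h) (Cod C (f n))"
    by metis
  have ObR: "Cod C (f n) \<in> Ob C" for n using fg by auto
  obtain R p where R: "is_product C UNIV (\<lambda>n. Cod C (f n)) R p"
    using ex_countable_product[OF prod, of "\<lambda>n. Cod C (f n)"] ObR by auto
  note p = product_projection[OF R]
  obtain t where t: "t \<in> Arr C" "Dom C t = A" "Cod C t = R" "\<And>n. p n \<cdot> t = d n"
    using product_lift[OF R A, of d] d by auto
  obtain e where "is_kernel C e t" using ex_kernel[OF t(1)] by blast
  note e = is_kernelD[OF this]
  have "factors_through C h e \<longleftrightarrow> (\<forall>(f, g) \<in> S. f \<cdot> h = g \<cdot> h)"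
    if h: "h \<in> Arr C" "Cod C h = A" for h
  proof -
    have ph: "p n \<cdot> t \<cdot> h = d n \<cdot> h" for n
      using Comp_assoc_Arr[of h t "p n"] h t p by simp
    have "factors_through C h e \<longleftrightarrow> t \<cdot> h = Zero C (Dom C h) R"
      using e(6)[of h] h t by simp
    also have "\<dots> \<longleftrightarrow> (\<forall>n. d n \<cdot> h = Zero C (Dom C h) (Cod C (f n)))"
    proof
      assume *: "t \<cdot> h = Zero C (Dom C h) R"
      show "\<forall>n. d n \<cdot> h = Zero C (Dom C h) (Cod C (f n))"
      proof
        fix n show "d n \<cdot> h = Zero C (Dom C h) (Cod C (f n))"
          using ph[of n, symmetric] p h unfolding * by simp
      qed
    next
      assume *: "\<forall>n. d n \<cdot> h = Zero C (Dom C h) (Cod C (f n))"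
      show "t \<cdot> h = Zero C (Dom C h) R"
        by (rule jointly_monic_cancel[OF product_jointly_monic[OF R]]) (use * ph t h p in simp_all)
    qed
    also have "\<dots> \<longleftrightarrow> (\<forall>n. f n \<cdot> h = g n \<cdot> h)" using d_iff[OF h] by simp
    also have "\<dots> \<longleftrightarrow> (\<forall>x \<in> range (from_nat_into S'). fst x \<cdot> h = snd x \<cdot> h)"
      by (simp add: f_def g_def)
    also have "\<dots> \<longleftrightarrow> (\<forall>(f, g) \<in> S. f \<cdot> h = g \<cdot> h)"
      unfolding range by (auto simp: S'_def)
    finally show ?thesis .
  qed
  then show ?thesis using e(1,4) t(2) by (intro exI[of _ e]) simp
qed

text \<open>By normality each \<open>m n\<close> is the kernel of some \<open>f n\<close>, so the
  intersection is the joint equalizer of the pairs consisting of \<open>f n\<close> and a zero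
  morphism.\<close>

lemma ex_intersection:
  fixes m :: "nat \<Rightarrow> 'a"
  assumes "has_countable_products C" "A \<in> Ob C" "\<And>n. is_mono C (m n)" "\<And>n. Cod C (m n) = A"
  shows "\<exists>u. is_intersection C A UNIV m u"
proof -
  have "\<forall>n. \<exists>f. is_kernel C (m n) f" using mono_normal assms(3) by blast
  then obtain f where f: "\<And>n. is_kernel C (m n) (f n)" by metis
  note fD = is_kernelD[OF f]
  let ?S = "range (\<lambda>n. (f n, Zero C A (Cod C (f n))))"
  have "\<exists>e. is_mono C e \<and> Cod C e = A \<and>
    (\<forall>h \<in> Arr C. Cod C h = A \<longrightarrow> (factors_through C h e \<longleftrightarrow> (\<forall>(f, g) \<in> ?S. f \<cdot> h = g \<cdot> h)))"
    using assms fD(3) fD(4)[symmetric] by (intro ex_joint_equalizer) auto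
  then obtain u where u: "is_mono C u" "Cod C u = A"
    and u_iff: "\<And>h. \<lbrakk>h \<in> Arr C; Cod C h = A\<rbrakk> \<Longrightarrow>
      factors_through C h u \<longleftrightarrow> (\<forall>n. f n \<cdot> h = Zero C A (Cod C (f n)) \<cdot> h)"
    by auto
  have iff: "factors_through C h u \<longleftrightarrow> (\<forall>n. factors_through C h (m n))"
    if "h \<in> Arr C" "Cod C h = A" for h
    using u_iff[OF that] that fD(3,6) fD(4)[symmetric] assms by simp
  have uA: "u \<in> Arr C" using u by (simp add: is_mono_def)
  then have "factors_through C u u"
    by (auto simp: factors_through_iff intro!: bexI[of _ "Idn C (Dom C u)"])
  with iff[OF uA u(2)] show ?thesis
    using u iff assms by (auto simp: is_intersection_def is_subobject_def)
qed

end


section \<open>Tensor products of monomorphisms and of jointly monic families\<close>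

context monoidal_category
begin

declare TensOb_in_Ob [simp] TUnit_in_Ob [simp] TensArr_Idn [simp]

lemma TensArr_Arr [simp]:
  assumes "f \<in> Arr C" "g \<in> Arr C"
  shows "f \<boxtimes> g \<in> Arr C" "Dom C (f \<boxtimes> g) = Dom C f \<odot> Dom C g" "Cod C (f \<boxtimes> g) = Cod C f \<odot> Cod C g"
  using TensArr_in_Hom[of f "Dom C f" "Cod C f" g "Dom C g" "Cod C g"] assms
  by (auto simp: in_Hom_iff)

lemma interchange [simp]:
  assumes "f \<in> Arr C" "f' \<in> Arr C" "g \<in> Arr C" "g' \<in> Arr C" "Cod C f = Dom C f'" "Cod C g = Dom C g'"
  shows "(f' \<boxtimes> g') \<cdot> (f \<boxtimes> g) = (f' \<cdot> f) \<boxtimes> (g' \<cdot> g)"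
  using TensArr_Comp[of f "Dom C f" "Dom C f'" f' "Cod C f'" g "Dom C g" "Dom C g'" g' "Cod C g'"] assms
  by (simp add: in_Hom_iff)

text \<open>Simplification nests composites to the right, so the interchange law is also needed in
  front of a remaining factor \<open>h\<close>.\<close>

lemma interchange_Comp [simp]:
  assumes "f \<in> Arr C" "f' \<in> Arr C" "g \<in> Arr C" "g' \<in> Arr C" "Cod C f = Dom C f'" "Cod C g = Dom C g'"
    and "h \<in> Arr C" "Cod C h = Dom C f \<odot> Dom C g"
  shows "(f' \<boxtimes> g') \<cdot> (f \<boxtimes> g) \<cdot> h = ((f' \<cdot> f) \<boxtimes> (g' \<cdot> g)) \<cdot> h"
proof -
  have "(f' \<boxtimes> g') \<cdot> (f \<boxtimes> g) \<cdot> h = ((f' \<boxtimes> g') \<cdot> (f \<boxtimes> g)) \<cdot> h"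
    by (rule Comp_assoc_Arr[symmetric]) (use assms in simp_all)
  then show ?thesis using assms by simp
qed

lemma structure_Arr [simp]:
  assumes "A \<in> Ob C"
  shows "LUnit C A \<in> Arr C" "Dom C (LUnit C A) = TUnit C \<odot> A" "Cod C (LUnit C A) = A"
    "RUnit C A \<in> Arr C" "Dom C (RUnit C A) = A \<odot> TUnit C" "Cod C (RUnit C A) = A"
    "\<lbrakk>B \<in> Ob C; D \<in> Ob C\<rbrakk> \<Longrightarrow> Assoc C A B D \<in> Arr C"
    "\<lbrakk>B \<in> Ob C; D \<in> Ob C\<rbrakk> \<Longrightarrow> Dom C (Assoc C A B D) = (A \<odot> B) \<odot> D"
    "\<lbrakk>B \<in> Ob C; D \<in> Ob C\<rbrakk> \<Longrightarrow> Cod C (Assoc C A B D) = A \<odot> (B \<odot> D)"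
  using LUnit_in_Hom[OF assms] RUnit_in_Hom[OF assms] Assoc_in_Hom[OF assms, of B D]
  by (auto simp: in_Hom_iff)

end

context abelian_tensor_category
begin

lemma Zero_TensArr:
  assumes "A \<in> Ob C" "B \<in> Ob C" "g \<in> Arr C"
  shows "Zero C A B \<boxtimes> g = Zero C (A \<odot> Dom C g) (B \<odot> Cod C g)"
proof -
  have Z: "Zero C A B \<in> Hom C A B" "g \<in> Hom C (Dom C g) (Cod C g)"
    using assms by (auto simp: in_Hom_iff)
  have "(Zero C A B \<boxtimes> g) \<oplus> (Zero C A B \<boxtimes> g) = Zero C A B \<boxtimes> g"
    using Plus_TensArr[OF Z(1) Z(1) Z(2)] Plus_Zero[OF Z(1)] by simp
  then show ?thesis using Plus_eq_right_iff TensArr_in_Hom[OF Z] by blast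
qed

lemma TensArr_Zero:
  assumes "A \<in> Ob C" "B \<in> Ob C" "g \<in> Arr C"
  shows "g \<boxtimes> Zero C A B = Zero C (Dom C g \<odot> A) (Cod C g \<odot> B)"
proof -
  have Z: "Zero C A B \<in> Hom C A B" "g \<in> Hom C (Dom C g) (Cod C g)"
    using assms by (auto simp: in_Hom_iff)
  have "(g \<boxtimes> Zero C A B) \<oplus> (g \<boxtimes> Zero C A B) = g \<boxtimes> Zero C A B"
    using TensArr_Plus[OF Z(2) Z(1) Z(1)] Plus_Zero[OF Z(1)] by simp
  then show ?thesis using Plus_eq_right_iff TensArr_in_Hom[OF Z(2,1)] by blast
qed

end

context abelian_category
begin

text \<open>A morphism contained in all the kernels is killed by every \<open>u i\<close>, hence is
  zero by joint monicity. The kernels are listed along \<open>from_nat\<close>, which reaches every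
  index because the index type is countable.\<close>

lemma ex_zero_intersection:
  fixes u :: "'i::countable \<Rightarrow> 'a" and k :: "'i \<Rightarrow> 'a"
  assumes u: "jointly_monic C A u" and k: "\<And>i. is_kernel C (k i) (u i)" and A: "A \<in> Ob C"
  shows "\<exists>Z \<in> Ob C. is_intersection C A UNIV (\<lambda>n :: nat. k (from_nat n)) (Zero C Z A)"
proof -
  obtain Z where Z: "is_zero_object C Z" using ex_zero_object by blast
  then have ZOb [simp]: "Z \<in> Ob C" by (simp add: is_zero_object_def)
  note kD = is_kernelD[OF k]
  have uD: "Dom C (u i) = A" for i using u by (simp add: jointly_monic_def)
  have mono: "is_mono C (Zero C Z A)"
  proof (rule is_monoI)
    fix f g
    assume "f \<in> Arr C" "g \<in> Arr C" "Cod C f = Dom C (Zero C Z A)" "Cod C g = Dom C (Zero C Z A)"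
      "Dom C f = Dom C g"
    then have "f \<in> Hom C (Dom C g) Z" "g \<in> Hom C (Dom C g) Z" "Dom C g \<in> Ob C"
      using A by (auto simp: in_Hom_iff)
    then show "f = g" using Z by (auto simp: is_zero_object_def)
  qed (simp add: A)
  have fac: "factors_through C (Zero C Z A) (k (from_nat n))" for n :: nat
    using kD(2)[of "from_nat n"] kD(4)[of "from_nat n"] A
    by (auto simp: factors_through_iff uD intro!: bexI[of _ "Zero C Z (Dom C (k (from_nat n)))"])
  have "factors_through C f (Zero C Z A)"
    if f: "f \<in> Arr C" "Cod C f = A" "\<And>n. factors_through C f (k (from_nat n))" for f
  proof -
    have "u i \<cdot> f = u i \<cdot> Zero C (Dom C f) A" for i
    proof -
      have "u i \<cdot> f = Zero C (Dom C f) (Cod C (u i))"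
        using kD(6)[of f i] f(3)[of "to_nat i"] f(1,2) uD by simp
      then show ?thesis using kD(3)[of i] f uD by simp
    qed
    then have "f = Zero C (Dom C f) A"
      by (intro jointly_monic_cancel[OF u, of f "Zero C (Dom C f) A"]) (use f A in simp_all)
    then show ?thesis
      by (intro factors_throughI[of "Zero C (Dom C f) Z"]) (use f(1,2) A in simp_all)
  qed
  then show ?thesis
    using mono fac kD A uD by (auto simp: is_intersection_def is_subobject_def intro!: bexI[of _ Z])
qed

end

locale cofree_setting = abelian_tensor_category C
  for C :: "('o, 'a, 'm) tensor_category_scheme" (structure) +
  assumes products: "has_countable_products C"
    and exact: "tensor_exact C"
    and intersections: "tensor_commutes_countable_intersections C"

context cofree_setting
begin

lemma short_exact_tensor:
  assumes "short_exact C f g" "Y \<in> Ob C"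
  shows "short_exact C (f \<boxtimes> Idn C Y) (g \<boxtimes> Idn C Y)" "short_exact C (Idn C Y \<boxtimes> f) (Idn C Y \<boxtimes> g)"
  using exact assms by (auto simp: tensor_exact_def)

lemma intersection_tensor:
  fixes m :: "nat \<Rightarrow> 'a"
  assumes "is_intersection C B UNIV m u" "Y \<in> Ob C"
  shows "is_intersection C (B \<odot> Y) UNIV (\<lambda>i. m i \<boxtimes> Idn C Y) (u \<boxtimes> Idn C Y)"
    "is_intersection C (Y \<odot> B) UNIV (\<lambda>i. Idn C Y \<boxtimes> m i) (Idn C Y \<boxtimes> u)"
  using intersections assms unfolding tensor_commutes_countable_intersections_def by blast+

text \<open>\<open>m \<boxtimes> n\<close> is the composite of \<open>m \<boxtimes> Idn\<close> with
  \<open>Idn \<boxtimes> n\<close>, and exactness in each variable makes both factors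
  kernels.\<close>

lemma is_mono_tensor:
  assumes "is_mono C m" "is_mono C n"
  shows "is_mono C (m \<boxtimes> n)"
proof -
  obtain c d where cd: "short_exact C m c" "short_exact C n d"
    using short_exact_cokernel assms by blast
  have mn: "m \<in> Arr C" "n \<in> Arr C" using assms by (auto simp: is_mono_def)
  have "is_mono C (m \<boxtimes> Idn C (Cod C n))" "is_mono C (Idn C (Dom C m) \<boxtimes> n)"
    using short_exact_tensor[OF cd(1), of "Cod C n"] short_exact_tensor[OF cd(2), of "Dom C m"] mn
    by (auto simp: short_exact_def is_kernelD(1))
  from is_mono_Comp[OF this] show ?thesis using mn by simp
qed

text \<open>Serves to tensor jointly monic families repeatedly: the projections from P \<otimes> P
  have to be epimorphisms again before a third factor can be added.\<close>

lemma is_epi_tensor: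
  assumes "is_epi C m" "is_epi C n"
  shows "is_epi C (m \<boxtimes> n)"
proof -
  obtain c d where cd: "short_exact C c m" "short_exact C d n"
    using short_exact_kernel assms by blast
  have mn: "m \<in> Arr C" "n \<in> Arr C" using assms by (auto simp: is_epi_def)
  have "is_epi C (m \<boxtimes> Idn C (Dom C n))" "is_epi C (Idn C (Cod C m) \<boxtimes> n)"
    using short_exact_tensor[OF cd(1), of "Dom C n"] short_exact_tensor[OF cd(2), of "Cod C m"] mn
    by (auto simp: short_exact_def is_cokernel_epi)
  from is_epi_Comp[OF this] show ?thesis using mn by simp
qed

text \<open>
  Joint monicity says that the kernels intersect in zero, and this is preserved because
  tensoring commutes with kernels and with countable intersections.
\<close>

lemma jointly_monic_tensor_Idn:
  fixes u :: "'i::countable \<Rightarrow> 'a"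
  assumes u: "jointly_monic C A u" "\<And>i. is_epi C (u i)" and Y: "Y \<in> Ob C"
  shows "jointly_monic C (A \<odot> Y) (\<lambda>i. u i \<boxtimes> Idn C Y)"
    and "jointly_monic C (Y \<odot> A) (\<lambda>i. Idn C Y \<boxtimes> u i)"
proof -
  have uD: "u i \<in> Arr C" "Dom C (u i) = A" for i using u(1) by (auto simp: jointly_monic_def)
  then have A: "A \<in> Ob C" by (metis Dom_in_Ob)
  have "\<forall>i. \<exists>k. short_exact C k (u i)" using short_exact_kernel u(2) by blast
  then obtain k where k: "\<And>i. short_exact C (k i) (u i)" by metis
  then have "\<And>i. is_kernel C (k i) (u i)" by (simp add: short_exact_def)
  from ex_zero_intersection[OF u(1) this A]
  obtain Z where Z: "Z \<in> Ob C" "is_intersection C A UNIV (\<lambda>n :: nat. k (from_nat n)) (Zero C Z A)"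
    by blast
  have zero: "f = Zero C (Dom C f) (Cod C f)"
    if f: "factors_through C f (Zero C V B)" and VB: "V \<in> Ob C" "B \<in> Ob C" for f V B
  proof -
    obtain h where h: "h \<in> Arr C" "Cod C h = Dom C (Zero C V B)" "f = Zero C V B \<cdot> h"
      using f unfolding factors_through_iff by blast
    show ?thesis unfolding h(3) using h(1,2) VB by simp
  qed
  show "jointly_monic C (A \<odot> Y) (\<lambda>i. u i \<boxtimes> Idn C Y)"
  proof (rule jointly_monicI)
    fix f
    assume f: "f \<in> Arr C" "Cod C f = A \<odot> Y"
      "\<And>i. (u i \<boxtimes> Idn C Y) \<cdot> f = Zero C (Dom C f) (Cod C (u i \<boxtimes> Idn C Y))"
    \<comment> \<open>Exactness makes \<open>k i \<boxtimes> Idn C Y\<close> the kernel of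
      \<open>u i \<boxtimes> Idn C Y\<close>, so vanishing turns into containment.\<close>
    have "factors_through C f (k i \<boxtimes> Idn C Y)" for i
      using is_kernelD(6)[of "k i \<boxtimes> Idn C Y" "u i \<boxtimes> Idn C Y" f] f Y uD short_exact_tensor(1)[OF k Y]
      by (simp add: short_exact_def)
    then have "factors_through C f (Zero C Z A \<boxtimes> Idn C Y)"
      using intersection_tensor(1)[OF Z(2) Y] f(1,2) by (simp add: is_intersection_def)
    then show "f = Zero C (Dom C f) (A \<odot> Y)"
      using zero[of f "Z \<odot> Y" "A \<odot> Y"] f(1,2) Z(1) A Y by (simp add: Zero_TensArr)
  qed (use uD Y in simp_all)
  show "jointly_monic C (Y \<odot> A) (\<lambda>i. Idn C Y \<boxtimes> u i)"
  proof (rule jointly_monicI)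
    fix f
    assume f: "f \<in> Arr C" "Cod C f = Y \<odot> A"
      "\<And>i. (Idn C Y \<boxtimes> u i) \<cdot> f = Zero C (Dom C f) (Cod C (Idn C Y \<boxtimes> u i))"
    have "factors_through C f (Idn C Y \<boxtimes> k i)" for i
      using is_kernelD(6)[of "Idn C Y \<boxtimes> k i" "Idn C Y \<boxtimes> u i" f] f Y uD short_exact_tensor(2)[OF k Y]
      by (simp add: short_exact_def)
    then have "factors_through C f (Idn C Y \<boxtimes> Zero C Z A)"
      using intersection_tensor(2)[OF Z(2) Y] f(1,2) by (simp add: is_intersection_def)
    then show "f = Zero C (Dom C f) (Y \<odot> A)"
      using zero[of f "Y \<odot> Z" "Y \<odot> A"] f(1,2) Z(1) A Y by (simp add: TensArr_Zero)
  qed (use uD Y in simp_all)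
qed

text \<open>Since \<open>u i \<boxtimes> v j\<close> equals \<open>Idn \<boxtimes> v j\<close> after
  \<open>u i \<boxtimes> Idn\<close>, the two one-variable results apply in turn: for fixed
  \<open>i\<close> the \<open>v j\<close> are cancelled on \<open>Cod C (u i) \<odot> B\<close>,
  then the \<open>u i\<close> on \<open>A \<odot> B\<close>.\<close>

lemma jointly_monic_tensor:
  fixes u :: "'i::countable \<Rightarrow> 'a" and v :: "'j::countable \<Rightarrow> 'a"
  assumes u: "jointly_monic C A u" "\<And>i. is_epi C (u i)"
    and v: "jointly_monic C B v" "\<And>j. is_epi C (v j)"
  shows "jointly_monic C (A \<odot> B) (\<lambda>(i, j). u i \<boxtimes> v j)"
proof (rule jointly_monicI)
  have uD [simp]: "u i \<in> Arr C" "Dom C (u i) = A" for i using u(1) by (auto simp: jointly_monic_def)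
  have vD [simp]: "v j \<in> Arr C" "Dom C (v j) = B" for j using v(1) by (auto simp: jointly_monic_def)
  have A: "A \<in> Ob C" and B: "B \<in> Ob C" using uD vD by (metis Dom_in_Ob)+
  show "(case x of (i, j) \<Rightarrow> u i \<boxtimes> v j) \<in> Arr C"
    "Dom C (case x of (i, j) \<Rightarrow> u i \<boxtimes> v j) = A \<odot> B" for x
    by (simp_all split: prod.split)
  fix f
  assume f: "f \<in> Arr C" "Cod C f = A \<odot> B"
    "\<And>x. (case x of (i, j) \<Rightarrow> u i \<boxtimes> v j) \<cdot> f
      = Zero C (Dom C f) (Cod C (case x of (i, j) \<Rightarrow> u i \<boxtimes> v j))"
  have "(u i \<boxtimes> Idn C B) \<cdot> f = (u i \<boxtimes> Idn C B) \<cdot> Zero C (Dom C f) (A \<odot> B)" for i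
  proof (rule jointly_monic_cancel[OF jointly_monic_tensor_Idn(2)[OF v, of "Cod C (u i)"]])
    show "(Idn C (Cod C (u i)) \<boxtimes> v j) \<cdot> (u i \<boxtimes> Idn C B) \<cdot> f
      = (Idn C (Cod C (u i)) \<boxtimes> v j) \<cdot> (u i \<boxtimes> Idn C B) \<cdot> Zero C (Dom C f) (A \<odot> B)" for j
      using f(1,2) f(3)[of "(i, j)"] A B by simp
  qed (use f(1,2) A B in simp_all)
  then show "f = Zero C (Dom C f) (A \<odot> B)"
    by (intro jointly_monic_cancel[OF jointly_monic_tensor_Idn(1)[OF u B], of f "Zero C (Dom C f) (A \<odot> B)"])
      (use f(1,2) A B in simp_all)
qed


section \<open>The largest subobject closed under a partial comultiplication\<close>

text \<open>Commutation with intersections acts on one factor at a time, and so places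
  \<open>h\<close> in w \<otimes> P and in P \<otimes> w separately. What remains is that these two
  subobjects of P \<otimes> P meet in w \<otimes> w, which exactness provides.\<close>

lemma intersection_tensor_square:
  fixes z :: "nat \<Rightarrow> 'a"
  assumes w: "is_intersection C P UNIV z w" and h: "h \<in> Arr C" "Cod C h = P \<odot> P"
    and fac: "\<And>n. factors_through C h (z n \<boxtimes> z n)"
  shows "factors_through C h (w \<boxtimes> w)"
proof -
  have P [simp]: "P \<in> Ob C" using w by (simp add: is_intersection_def)
  have wm: "is_mono C w" "Cod C w = P" using w by (auto simp: is_intersection_def is_subobject_def)
  then have wA [simp]: "w \<in> Arr C" by (simp add: is_mono_def)
  have z [simp]: "z n \<in> Arr C" "Cod C (z n) = P" for n
    using w by (auto simp: is_intersection_def is_subobject_def is_mono_def)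
  have "factors_through C (z n \<boxtimes> z n) (z n \<boxtimes> Idn C P)" for n
    by (rule factors_throughI[of "Idn C (Dom C (z n)) \<boxtimes> z n"]) simp_all
  moreover have "factors_through C (z n \<boxtimes> z n) (Idn C P \<boxtimes> z n)" for n
    by (rule factors_throughI[of "z n \<boxtimes> Idn C (Dom C (z n))"]) simp_all
  ultimately have "factors_through C h (z n \<boxtimes> Idn C P)" "factors_through C h (Idn C P \<boxtimes> z n)" for n
    using factors_through_trans[OF fac[of n]] by simp_all
  then have "factors_through C h (w \<boxtimes> Idn C P)" "factors_through C h (Idn C P \<boxtimes> w)"
    using intersection_tensor[OF w P] h by (simp_all add: is_intersection_def)
  then obtain k l where "k \<in> Arr C" "Dom C k = Dom C h" "Cod C k = Dom C (w \<boxtimes> Idn C P)"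
      "h = (w \<boxtimes> Idn C P) \<cdot> k"
    and "l \<in> Arr C" "Dom C l = Dom C h" "Cod C l = Dom C (Idn C P \<boxtimes> w)" "h = (Idn C P \<boxtimes> w) \<cdot> l"
    unfolding factors_through_iff by blast
  then have k: "k \<in> Arr C" "Dom C k = Dom C h" "Cod C k = Dom C w \<odot> P" "h = (w \<boxtimes> Idn C P) \<cdot> k"
    and l: "l \<in> Arr C" "Dom C l = Dom C h" "Cod C l = P \<odot> Dom C w" "h = (Idn C P \<boxtimes> w) \<cdot> l"
    by simp_all
  obtain c where c: "short_exact C w c" using short_exact_cokernel[OF wm(1)] by blast
  then have "is_kernel C w c" by (simp add: short_exact_def)
  note cD = is_kernelD[OF this]
  have cA [simp]: "c \<in> Arr C" "Dom C c = P" using cD wm by auto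
  \<comment> \<open>With \<open>c\<close> the cokernel of \<open>w\<close>, the second factorization
    of \<open>h\<close> shows that \<open>c\<close> on the right factor kills \<open>h\<close>.
    Cancelling the monomorphism \<open>w \<boxtimes> Idn C (Cod C c)\<close> transfers this to
    \<open>k\<close>, so \<open>k\<close> factors through
    \<open>Idn C (Dom C w) \<boxtimes> w\<close>, the kernel of
    \<open>Idn C (Dom C w) \<boxtimes> c\<close>.\<close>
  have "(w \<boxtimes> Idn C (Cod C c)) \<cdot> (Idn C (Dom C w) \<boxtimes> c) \<cdot> k = (Idn C P \<boxtimes> c) \<cdot> (w \<boxtimes> Idn C P) \<cdot> k"
    using k(1-3) wm(2) by simp
  also have "\<dots> = (Idn C P \<boxtimes> c) \<cdot> (Idn C P \<boxtimes> w) \<cdot> l" unfolding k(4)[symmetric] l(4)[symmetric] ..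
  also have "\<dots> = (Idn C P \<boxtimes> (c \<cdot> w)) \<cdot> l" using l(1-3) wm(2) by simp
  also have "\<dots> = Zero C (Dom C h) (P \<odot> Cod C c)"
    unfolding cD(5) using l(1-3) by (simp add: TensArr_Zero)
  also have "\<dots> = (w \<boxtimes> Idn C (Cod C c)) \<cdot> Zero C (Dom C h) (Dom C w \<odot> Cod C c)"
    using h wm(2) by simp
  finally have "(Idn C (Dom C w) \<boxtimes> c) \<cdot> k = Zero C (Dom C h) (Dom C w \<odot> Cod C c)"
    by (rule is_mono_cancel[OF is_mono_tensor[OF wm(1) is_mono_Idn[of "Cod C c"]], rotated 6])
      (use k(1-3) h in simp_all)
  then have "factors_through C k (Idn C (Dom C w) \<boxtimes> w)"
    using is_kernelD(6)[of "Idn C (Dom C w) \<boxtimes> w" "Idn C (Dom C w) \<boxtimes> c" k] k(1-3)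
      short_exact_tensor(2)[OF c, of "Dom C w"] by (simp add: short_exact_def)
  from factors_through_Comp[OF this, of "w \<boxtimes> Idn C P"]
  show ?thesis unfolding k(4) using k(1,3) wm(2) by simp
qed

text \<open>
  \<open>D\<close> is a comultiplication on \<open>P = Dom D\<close> with values in an object containing \<open>P \<otimes> P\<close>. The
  largest subobject \<open>w \<le> e\<close> with \<open>D(w) \<le> w \<otimes> w\<close> is the intersection of the sequence
  \<open>z\<^sub>0 = e\<close>, \<open>z\<^sub>n\<^sub>+\<^sub>1 = D\<^sup>-\<^sup>1(z\<^sub>n \<otimes> z\<^sub>n)\<close>.
\<close>

lemma ex_largest_closed_subobject:
  assumes D: "D \<in> Arr C" "Dom C D = P" and M: "is_mono C M" "Dom C M = P \<odot> P" "Cod C M = Cod C D"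
    and e: "is_mono C e" "Cod C e = P"
  shows "\<exists>w. is_mono C w \<and> Cod C w = P \<and> factors_through C w e \<and>
    factors_through C (D \<cdot> w) (M \<cdot> (w \<boxtimes> w)) \<and>
    (\<forall>h \<in> Arr C. Cod C h = P \<longrightarrow> factors_through C h e \<longrightarrow>
      factors_through C (D \<cdot> h) (M \<cdot> (h \<boxtimes> h)) \<longrightarrow> factors_through C h w)"
proof -
  have P [simp]: "P \<in> Ob C" using D by auto
  have MA [simp]: "M \<in> Arr C" using M(1) by (simp add: is_mono_def)
  have "\<exists>m'. is_mono C m' \<and> Cod C m' = P \<and> (\<forall>h \<in> Arr C. Cod C h = P \<longrightarrow>
      (factors_through C h m' \<longleftrightarrow> factors_through C (D \<cdot> h) (M \<cdot> (m \<boxtimes> m))))"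
    if m: "is_mono C m" "Cod C m = P" for m
  proof -
    have mA: "m \<in> Arr C" using m by (simp add: is_mono_def)
    have "is_mono C (M \<cdot> (m \<boxtimes> m))"
      by (rule is_mono_Comp[OF M(1) is_mono_tensor[OF m(1) m(1)]]) (use mA m M in simp)
    from ex_mono_pullback[OF D(1) this] show ?thesis using mA m M D by simp
  qed
  then obtain st where st: "\<And>m. \<lbrakk>is_mono C m; Cod C m = P\<rbrakk> \<Longrightarrow> is_mono C (st m) \<and> Cod C (st m) = P"
    and st_iff: "\<And>m h. \<lbrakk>is_mono C m; Cod C m = P; h \<in> Arr C; Cod C h = P\<rbrakk> \<Longrightarrow>
      factors_through C h (st m) \<longleftrightarrow> factors_through C (D \<cdot> h) (M \<cdot> (m \<boxtimes> m))"
    by metis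
  define z where "z n = (st ^^ n) e" for n
  have z: "is_mono C (z n)" "Cod C (z n) = P" for n
    by (induction n) (auto simp: z_def st e)
  have zA [simp]: "z n \<in> Arr C" for n using z(1) by (simp add: is_mono_def)
  have z_Suc: "factors_through C h (z (Suc n)) \<longleftrightarrow> factors_through C (D \<cdot> h) (M \<cdot> (z n \<boxtimes> z n))"
    if "h \<in> Arr C" "Cod C h = P" for h n
    using st_iff[OF z that, of n] by (simp add: z_def)
  obtain w where w: "is_intersection C P UNIV z w"
    using ex_intersection[OF products P, of z] z by blast
  have wm: "is_mono C w" "Cod C w = P" using w by (auto simp: is_intersection_def is_subobject_def)
  then have wA [simp]: "w \<in> Arr C" by (simp add: is_mono_def)
  have w_z: "factors_through C w (z n)" for n using w by (simp add: is_intersection_def)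
  \<comment> \<open>The shift of index matters: containment of \<open>w\<close> in the term with
    index \<open>Suc n\<close> bounds the image of \<open>w\<close> by the square of the term with
    index \<open>n\<close>, for every \<open>n\<close>.\<close>
  have "factors_through C (D \<cdot> w) (M \<cdot> (z n \<boxtimes> z n))" for n
    using z_Suc[OF wA wm(2)] w_z by blast
  then have "\<forall>n. \<exists>k \<in> Arr C. Dom C k = Dom C (D \<cdot> w) \<and> Cod C k = Dom C (M \<cdot> (z n \<boxtimes> z n)) \<and>
      D \<cdot> w = (M \<cdot> (z n \<boxtimes> z n)) \<cdot> k"
    unfolding factors_through_iff by blast
  then obtain k where "\<forall>n. k n \<in> Arr C \<and> Dom C (k n) = Dom C (D \<cdot> w) \<and>
      Cod C (k n) = Dom C (M \<cdot> (z n \<boxtimes> z n)) \<and> D \<cdot> w = (M \<cdot> (z n \<boxtimes> z n)) \<cdot> k n"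
    by metis
  then have k: "k n \<in> Arr C" "Dom C (k n) = Dom C w" "Cod C (k n) = Dom C (z n) \<odot> Dom C (z n)"
      and "D \<cdot> w = (M \<cdot> (z n \<boxtimes> z n)) \<cdot> k n" for n
    using D M z(2) wm(2) by simp_all
  then have k_eq: "D \<cdot> w = M \<cdot> (z n \<boxtimes> z n) \<cdot> k n" for n
    using M(2) z(2) by simp
  \<comment> \<open>The lift of \<open>D \<cdot> w\<close> to P \<otimes> P. As \<open>M\<close> is
    a monomorphism, every \<open>k n\<close> yields the same lift, which therefore lies in all the
    squares at once.\<close>
  let ?h = "(z 0 \<boxtimes> z 0) \<cdot> k 0"
  have "factors_through C ?h (z n \<boxtimes> z n)" for n
  proof (rule factors_throughI[of "k n"])
    show "?h = (z n \<boxtimes> z n) \<cdot> k n"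
      by (rule is_mono_cancel[OF M(1) _ _ _ _ _ trans[OF k_eq[symmetric] k_eq]])
        (simp_all add: k M z(2))
  qed (simp_all add: k z(2))
  then have "factors_through C ?h (w \<boxtimes> w)"
    by (intro intersection_tensor_square[OF w]) (simp_all add: k z(2))
  from factors_through_Comp[OF this, of M]
  have closed: "factors_through C (D \<cdot> w) (M \<cdot> (w \<boxtimes> w))"
    unfolding k_eq[of 0] using M(2) wm(2) by simp
  have "factors_through C h w"
    if h: "h \<in> Arr C" "Cod C h = P" "factors_through C h e" "factors_through C (D \<cdot> h) (M \<cdot> (h \<boxtimes> h))" for h
  proof -
    \<comment> \<open>Containment of \<open>h\<close> in \<open>z n\<close> gives containment of
      \<open>h \<boxtimes> h\<close> in the square of \<open>z n\<close>; the closure property of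
      \<open>h\<close> then places it in the preimage, which is the next term.\<close>
    have "factors_through C h (z n)" for n
    proof (induction n)
      case 0
      show ?case using h(3) by (simp add: z_def)
    next
      case (Suc n)
      then obtain l where l: "l \<in> Arr C" "Cod C l = Dom C (z n)" "h = z n \<cdot> l"
        unfolding factors_through_iff by blast
      have "factors_through C (h \<boxtimes> h) (z n \<boxtimes> z n)"
        unfolding l(3) by (rule factors_throughI[of "l \<boxtimes> l"]) (use l(1,2) in simp_all)
      then have "factors_through C (M \<cdot> (h \<boxtimes> h)) (M \<cdot> (z n \<boxtimes> z n))"
        by (rule factors_through_Comp) (simp_all add: z(2) M(2))
      then show ?case
        unfolding z_Suc[OF h(1,2)]
        by (rule factors_through_trans[OF h(4)]) (simp add: z(2) M(2))
    qed
    then show ?thesis using w h(1,2) by (simp add: is_intersection_def)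
  qed
  moreover have "factors_through C w e" using w_z[of 0] by (simp add: z_def)
  ultimately show ?thesis using wm closed by blast
qed

end


section \<open>The cofree coalgebra\<close>

text \<open>
  Indexing the tensor powers of \<open>X\<close> by bracketings instead of natural numbers makes the iterated
  comultiplications definable without any coherence theorem.
\<close>

datatype bracketing = Empty | Var | Join bracketing bracketing

instance bracketing :: countable
  by countable_datatype

context monoidal_category
begin

primrec tensor_power :: "'o \<Rightarrow> bracketing \<Rightarrow> 'o" where
  "tensor_power X Empty = TUnit C"
| "tensor_power X Var = X"
| "tensor_power X (Join s t) = tensor_power X s \<odot> tensor_power X t"

primrec iterated_comult :: "('o, 'a) coalgebra \<Rightarrow> 'a \<Rightarrow> bracketing \<Rightarrow> 'a" where
  "iterated_comult K f Empty = Counit K"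
| "iterated_comult K f Var = f"
| "iterated_comult K f (Join s t) = (iterated_comult K f s \<boxtimes> iterated_comult K f t) \<cdot> Comult K"

lemma tensor_power_in_Ob [simp]: "X \<in> Ob C \<Longrightarrow> tensor_power X t \<in> Ob C"
  by (induction t) simp_all

text \<open>
  The identities that coassociativity and counitality impose on the iterated comultiplications of a
  coalgebra with underlying object \<open>A\<close>.
\<close>

definition coalgebra_family :: "'o \<Rightarrow> 'o \<Rightarrow> (bracketing \<Rightarrow> 'a) \<Rightarrow> bool" where
  "coalgebra_family X A q \<longleftrightarrow> A \<in> Ob C \<and> (\<forall>t. q t \<in> Hom C A (tensor_power X t)) \<and>
    (\<forall>r s t. Assoc C (tensor_power X r) (tensor_power X s) (tensor_power X t) \<cdot> q (Join (Join r s) t)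
      = q (Join r (Join s t))) \<and>
    (\<forall>t. LUnit C (tensor_power X t) \<cdot> q (Join Empty t) = q t) \<and>
    (\<forall>t. RUnit C (tensor_power X t) \<cdot> q (Join t Empty) = q t)"

end

context cofree_setting
begin

text \<open>Everything later used about \<open>W\<close>. Joint monicity on \<open>W\<close>, on its
  square and on its cube reduces, respectively, the counit laws and uniqueness, compatibility with
  comultiplication, and coassociativity to equations between the components
  \<open>q t\<close>.\<close>

lemma ex_universal_coalgebra_family:
  assumes X: "X \<in> Ob C"
  shows "\<exists>W q \<delta>. coalgebra_family X W q \<and> \<delta> \<in> Hom C W (W \<odot> W) \<and>
    (\<forall>s t. (q s \<boxtimes> q t) \<cdot> \<delta> = q (Join s t)) \<and>
    jointly_monic C W q \<and> jointly_monic C (W \<odot> W) (\<lambda>(s, t). q s \<boxtimes> q t) \<and>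
    jointly_monic C (W \<odot> (W \<odot> W)) (\<lambda>(r, s, t). q r \<boxtimes> (q s \<boxtimes> q t)) \<and>
    (\<forall>A f d. coalgebra_family X A f \<longrightarrow> d \<in> Hom C A (A \<odot> A) \<longrightarrow>
      (\<forall>s t. (f s \<boxtimes> f t) \<cdot> d = f (Join s t)) \<longrightarrow> (\<exists>h \<in> Hom C A W. \<forall>t. q t \<cdot> h = f t))"
proof -
  have pow [simp]: "tensor_power X t \<in> Ob C" for t using X by simp
  obtain P p where P: "is_product C UNIV (tensor_power X) P p"
    using ex_countable_product[OF products, of "tensor_power X"] by auto
  note pP [simp] = product_projection[OF P]
  have p_epi: "is_epi C (p t)" for t using product_projection_epi[OF P] .
  note p_jm = product_jointly_monic[OF P]
  have pp_jm: "jointly_monic C (P \<odot> P) (\<lambda>(s, t). p s \<boxtimes> p t)"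
    using jointly_monic_tensor[OF p_jm p_epi p_jm p_epi] .
  have "is_epi C (case x of (s, t) \<Rightarrow> p s \<boxtimes> p t)" for x
    using is_epi_tensor[OF p_epi p_epi] by (simp split: prod.split)
  from jointly_monic_tensor[OF p_jm p_epi pp_jm this]
  have ppp_jm: "jointly_monic C (P \<odot> (P \<odot> P)) (\<lambda>(r, s, t). p r \<boxtimes> (p s \<boxtimes> p t))"
    by (simp add: case_prod_unfold)
  let ?Y = "\<lambda>(s, t). tensor_power X s \<odot> tensor_power X t"
  have "?Y x \<in> Ob C" for x by (simp split: prod.split)
  then obtain Q \<kappa> where Q: "is_product C UNIV ?Y Q \<kappa>"
    using ex_countable_product[OF products, of ?Y] by auto
  note qQ [simp] = product_projection[OF Q]
  note \<kappa>_jm = product_jointly_monic[OF Q]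
  \<comment> \<open>Deconcatenation: its component at \<open>(s, t)\<close> is the projection of
    \<open>P\<close> to the power at \<open>Join s t\<close>.\<close>
  have "\<exists>D \<in> Arr C. Dom C D = P \<and> Cod C D = Q \<and> (\<forall>x. \<kappa> x \<cdot> D = p (Join (fst x) (snd x)))"
    by (rule product_lift[OF Q]) (simp_all split: prod.split)
  then obtain D where D [simp]: "D \<in> Arr C" "Dom C D = P" "Cod C D = Q"
    and \<kappa>D: "\<And>s t. \<kappa> (s, t) \<cdot> D = p (Join s t)" by auto
  have "\<exists>M \<in> Arr C. Dom C M = P \<odot> P \<and> Cod C M = Q \<and> (\<forall>x. \<kappa> x \<cdot> M = p (fst x) \<boxtimes> p (snd x))"
    by (rule product_lift[OF Q]) (simp_all split: prod.split)
  then obtain M where M [simp]: "M \<in> Arr C" "Dom C M = P \<odot> P" "Cod C M = Q"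
    and \<kappa>M: "\<And>s t. \<kappa> (s, t) \<cdot> M = p s \<boxtimes> p t" by auto
  have \<kappa>D_Comp: "\<kappa> (s, t) \<cdot> D \<cdot> h = p (Join s t) \<cdot> h" if "h \<in> Arr C" "Cod C h = P" for s t h
    using Comp_assoc_Arr[of h D "\<kappa> (s, t)"] that by (simp add: \<kappa>D)
  have \<kappa>M_Comp: "\<kappa> (s, t) \<cdot> M \<cdot> h = (p s \<boxtimes> p t) \<cdot> h" if "h \<in> Arr C" "Cod C h = P \<odot> P" for s t h
    using Comp_assoc_Arr[of h M "\<kappa> (s, t)"] that by (simp add: \<kappa>M)
  have M_mono: "is_mono C M"
  proof (rule is_monoI[OF M(1)])
    fix f g
    assume *: "f \<in> Arr C" "g \<in> Arr C" "Cod C f = Dom C M" "Cod C g = Dom C M" "Dom C f = Dom C g"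
      "M \<cdot> f = M \<cdot> g"
    \<comment> \<open>The components of \<open>M\<close> are the jointly monic family on P \<otimes>
      P, so \<open>M\<close> is a monomorphism.\<close>
    have "(p s \<boxtimes> p t) \<cdot> f = (p s \<boxtimes> p t) \<cdot> g" for s t
      using \<kappa>M_Comp[of f s t] \<kappa>M_Comp[of g s t] * by simp
    then show "f = g"
      by (intro jointly_monic_cancel[OF pp_jm, of f g]) (use * in \<open>auto split: prod.split\<close>)
  qed
  \<comment> \<open>One pair of parallel arrows out of \<open>P\<close> for each rebracketing and
    for each removal of a unit on the left or right; the triples and the bracketings are
    countable.\<close>
  let ?S = "range (\<lambda>(r, s, t). (Assoc C (tensor_power X r) (tensor_power X s) (tensor_power X t) \<cdot> p (Join (Join r s) t),
        p (Join r (Join s t)))) \<union> range (\<lambda>t. (LUnit C (tensor_power X t) \<cdot> p (Join Empty t), p t)) \<union>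
      range (\<lambda>t. (RUnit C (tensor_power X t) \<cdot> p (Join t Empty), p t))"
  have "\<exists>e. is_mono C e \<and> Cod C e = P \<and>
    (\<forall>h \<in> Arr C. Cod C h = P \<longrightarrow> (factors_through C h e \<longleftrightarrow> (\<forall>(f, g) \<in> ?S. f \<cdot> h = g \<cdot> h)))"
    by (rule ex_joint_equalizer[OF products]) (auto simp: pP)
  then obtain e where e: "is_mono C e" "Cod C e = P"
    and e_S: "\<And>h. \<lbrakk>h \<in> Arr C; Cod C h = P\<rbrakk> \<Longrightarrow>
      factors_through C h e \<longleftrightarrow> (\<forall>(f, g) \<in> ?S. f \<cdot> h = g \<cdot> h)" by blast
  have e_iff: "factors_through C h e \<longleftrightarrow> coalgebra_family X (Dom C h) (\<lambda>t. p t \<cdot> h)"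
    if "h \<in> Arr C" "Cod C h = P" for h
    unfolding e_S[OF that] ball_Un using that
    by (simp add: split_paired_All coalgebra_family_def in_Hom_iff)
  obtain w where w: "is_mono C w" "Cod C w = P" and w_e: "factors_through C w e"
    and w_closed: "factors_through C (D \<cdot> w) (M \<cdot> (w \<boxtimes> w))"
    and w_max: "\<And>h. \<lbrakk>h \<in> Arr C; Cod C h = P; factors_through C h e;
      factors_through C (D \<cdot> h) (M \<cdot> (h \<boxtimes> h))\<rbrakk> \<Longrightarrow> factors_through C h w"
    using ex_largest_closed_subobject[OF D(1,2) M_mono M(2) _ e] by auto
  have wA [simp]: "w \<in> Arr C" using w by (simp add: is_mono_def)
  define q where "q t = p t \<cdot> w" for t
  obtain \<delta> where \<delta>': "\<delta> \<in> Arr C" "Dom C \<delta> = Dom C (D \<cdot> w)" "Cod C \<delta> = Dom C (M \<cdot> (w \<boxtimes> w))"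
    "D \<cdot> w = (M \<cdot> (w \<boxtimes> w)) \<cdot> \<delta>"
    using w_closed unfolding factors_through_iff by blast
  have \<delta>: "\<delta> \<in> Arr C" "Dom C \<delta> = Dom C w" "Cod C \<delta> = Dom C w \<odot> Dom C w"
    using \<delta>'(1-3) w(2) by simp_all
  then have \<delta>_eq: "D \<cdot> w = M \<cdot> (w \<boxtimes> w) \<cdot> \<delta>"
    using \<delta>'(4) w(2) by simp
  have comult: "(q s \<boxtimes> q t) \<cdot> \<delta> = q (Join s t)" for s t
  proof -
    have "q (Join s t) = \<kappa> (s, t) \<cdot> D \<cdot> w" using \<kappa>D_Comp[OF wA w(2)] by (simp add: q_def)
    also have "\<dots> = (p s \<boxtimes> p t) \<cdot> (w \<boxtimes> w) \<cdot> \<delta>"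
      unfolding \<delta>_eq by (rule \<kappa>M_Comp) (use \<delta> w(2) in simp_all)
    also have "\<dots> = (q s \<boxtimes> q t) \<cdot> \<delta>" using \<delta> w(2) by (simp add: q_def)
    finally show ?thesis ..
  qed
  have family: "coalgebra_family X (Dom C w) q"
    using e_iff[OF wA w(2)] w_e by (simp add: q_def[abs_def])
  have q_jm: "jointly_monic C (Dom C w) q"
    using jointly_monic_Comp_mono[OF p_jm w] by (simp add: q_def[abs_def])
  have ww: "is_mono C (w \<boxtimes> w)" "Cod C (w \<boxtimes> w) = P \<odot> P"
    using is_mono_tensor[OF w(1) w(1)] w(2) by simp_all
  have qq_jm: "jointly_monic C (Dom C w \<odot> Dom C w) (\<lambda>(s, t). q s \<boxtimes> q t)"
    using jointly_monic_Comp_mono[OF pp_jm ww] w(2) by (simp add: q_def case_prod_unfold)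
  have "is_mono C (w \<boxtimes> (w \<boxtimes> w))" "Cod C (w \<boxtimes> (w \<boxtimes> w)) = P \<odot> (P \<odot> P)"
    using is_mono_tensor[OF w(1) ww(1)] w(2) by simp_all
  from jointly_monic_Comp_mono[OF ppp_jm this]
  have qqq_jm: "jointly_monic C (Dom C w \<odot> (Dom C w \<odot> Dom C w)) (\<lambda>(r, s, t). q r \<boxtimes> (q s \<boxtimes> q t))"
    using w(2) by (simp add: q_def case_prod_unfold)
  have univ: "\<exists>h \<in> Hom C A (Dom C w). \<forall>t. q t \<cdot> h = f t"
    if f: "coalgebra_family X A f" and d: "d \<in> Hom C A (A \<odot> A)"
      and fd: "\<And>s t. (f s \<boxtimes> f t) \<cdot> d = f (Join s t)" for A f d
  proof -
    have A [simp]: "A \<in> Ob C" and fA [simp]: "f t \<in> Arr C" "Dom C (f t) = A" "Cod C (f t) = tensor_power X t" for t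
      using f by (auto simp: coalgebra_family_def in_Hom_iff)
    have dA [simp]: "d \<in> Arr C" "Dom C d = A" "Cod C d = A \<odot> A" using d by (auto simp: in_Hom_iff)
    obtain h where h: "h \<in> Arr C" "Dom C h = A" "Cod C h = P" and ph: "\<And>t. p t \<cdot> h = f t"
      using product_lift[OF P A, of f] by auto
    \<comment> \<open>The closure condition for \<open>h\<close>, tested on the components of
      \<open>Q\<close>: both sides give \<open>f (Join s t)\<close>. It exhibits \<open>d\<close> as
      the required factorization.\<close>
    have "D \<cdot> h = M \<cdot> (h \<boxtimes> h) \<cdot> d"
    proof (rule jointly_monic_cancel[OF \<kappa>_jm])
      fix x :: "bracketing \<times> bracketing"
      obtain s t where x: "x = (s, t)" by (cases x)
      have "\<kappa> x \<cdot> M \<cdot> (h \<boxtimes> h) \<cdot> d = (p s \<boxtimes> p t) \<cdot> (h \<boxtimes> h) \<cdot> d"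
        unfolding x by (rule \<kappa>M_Comp) (use h in simp_all)
      also have "\<dots> = f (Join s t)" using h by (simp add: ph fd)
      finally show "\<kappa> x \<cdot> D \<cdot> h = \<kappa> x \<cdot> M \<cdot> (h \<boxtimes> h) \<cdot> d"
        unfolding x using \<kappa>D_Comp[OF h(1,3)] by (simp add: ph)
    qed (use h in simp_all)
    then have "factors_through C (D \<cdot> h) (M \<cdot> (h \<boxtimes> h))"
      by (intro factors_throughI[of d]) (use h in simp_all)
    moreover have "factors_through C h e" using e_iff[OF h(1,3)] f h(2) by (simp add: ph)
    ultimately have "factors_through C h w" using w_max[OF h(1,3)] by blast
    then obtain l where l: "l \<in> Arr C" "Dom C l = Dom C h" "Cod C l = Dom C w" "h = w \<cdot> l"
      unfolding factors_through_iff by blast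
    have "q t \<cdot> l = f t" for t
      unfolding ph[symmetric] l(4) using l(1,3) w(2) by (simp add: q_def)
    moreover have "l \<in> Hom C A (Dom C w)" using l(1-3) h(2) by (simp add: in_Hom_iff)
    ultimately show ?thesis by blast
  qed
  show ?thesis
  proof (intro exI conjI allI impI)
    show "\<delta> \<in> Hom C (Dom C w) (Dom C w \<odot> Dom C w)" using \<delta> by (simp add: in_Hom_iff)
    show "\<exists>h \<in> Hom C A (Dom C w). \<forall>t. q t \<cdot> h = f t"
      if "coalgebra_family X A f" "d \<in> Hom C A (A \<odot> A)" "\<forall>s t. (f s \<boxtimes> f t) \<cdot> d = f (Join s t)"
      for A f d
      using univ[OF that(1,2)] that(3) by blast
  qed (fact family comult q_jm qq_jm qqq_jm)+
qed

text \<open>Naturality of the associator and unitors moves the iterated comultiplications of the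
  factors past them; what is left next to \<open>Comult K\<close> is exactly one side of a coalgebra
  axiom. Induction on bracketings enters only for typing.\<close>

lemma coalgebra_family_iterated_comult:
  assumes K: "is_coalgebra C K" and f: "f \<in> Hom C (Underlying K) X" and X: "X \<in> Ob C"
  shows "coalgebra_family X (Underlying K) (iterated_comult K f)"
proof -
  let ?A = "Underlying K" and ?d = "Comult K" and ?e = "Counit K" and ?f = "iterated_comult K f"
  have A [simp]: "?A \<in> Ob C"
    and d [simp]: "?d \<in> Arr C" "Dom C ?d = ?A" "Cod C ?d = ?A \<odot> ?A"
    and e [simp]: "?e \<in> Arr C" "Dom C ?e = ?A" "Cod C ?e = TUnit C"
    and coassoc: "Assoc C ?A ?A ?A \<cdot> (?d \<boxtimes> Idn C ?A) \<cdot> ?d = (Idn C ?A \<boxtimes> ?d) \<cdot> ?d"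
    and lunit: "LUnit C ?A \<cdot> (?e \<boxtimes> Idn C ?A) \<cdot> ?d = Idn C ?A"
    and runit: "RUnit C ?A \<cdot> (Idn C ?A \<boxtimes> ?e) \<cdot> ?d = Idn C ?A"
    using K by (auto simp: is_coalgebra_def Let_def in_Hom_iff)
  have f_typ: "?f t \<in> Hom C ?A (tensor_power X t)" for t
    by (induction t) (use f X in \<open>simp_all add: in_Hom_iff\<close>)
  then have fA [simp]: "?f t \<in> Arr C" "Dom C (?f t) = ?A" "Cod C (?f t) = tensor_power X t" for t
    by (simp_all add: in_Hom_iff)
  have pow [simp]: "tensor_power X t \<in> Ob C" for t using X by simp
  have "Assoc C (tensor_power X r) (tensor_power X s) (tensor_power X t) \<cdot> ?f (Join (Join r s) t) = ?f (Join r (Join s t))" for r s t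
  proof -
    have "Assoc C (tensor_power X r) (tensor_power X s) (tensor_power X t) \<cdot> ?f (Join (Join r s) t)
        = (Assoc C (tensor_power X r) (tensor_power X s) (tensor_power X t) \<cdot> ((?f r \<boxtimes> ?f s) \<boxtimes> ?f t)) \<cdot> (?d \<boxtimes> Idn C ?A) \<cdot> ?d"
      by simp
    also have "\<dots> = (?f r \<boxtimes> (?f s \<boxtimes> ?f t)) \<cdot> Assoc C ?A ?A ?A \<cdot> (?d \<boxtimes> Idn C ?A) \<cdot> ?d"
      unfolding Assoc_natural[OF f_typ f_typ f_typ] by simp
    also have "\<dots> = ?f (Join r (Join s t))" unfolding coassoc by simp
    finally show ?thesis .
  qed
  moreover have "LUnit C (tensor_power X t) \<cdot> ?f (Join Empty t) = ?f t" for t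
  proof -
    have "LUnit C (tensor_power X t) \<cdot> ?f (Join Empty t)
        = (LUnit C (tensor_power X t) \<cdot> (Idn C (TUnit C) \<boxtimes> ?f t)) \<cdot> (?e \<boxtimes> Idn C ?A) \<cdot> ?d" by simp
    also have "\<dots> = ?f t \<cdot> LUnit C ?A \<cdot> (?e \<boxtimes> Idn C ?A) \<cdot> ?d"
      unfolding LUnit_natural[OF f_typ] by simp
    also have "\<dots> = ?f t" unfolding lunit by simp
    finally show ?thesis .
  qed
  moreover have "RUnit C (tensor_power X t) \<cdot> ?f (Join t Empty) = ?f t" for t
  proof -
    have "RUnit C (tensor_power X t) \<cdot> ?f (Join t Empty)
        = (RUnit C (tensor_power X t) \<cdot> (?f t \<boxtimes> Idn C (TUnit C))) \<cdot> (Idn C ?A \<boxtimes> ?e) \<cdot> ?d" by simp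
    also have "\<dots> = ?f t \<cdot> RUnit C ?A \<cdot> (Idn C ?A \<boxtimes> ?e) \<cdot> ?d"
      unfolding RUnit_natural[OF f_typ] by simp
    also have "\<dots> = ?f t" unfolding runit by simp
    finally show ?thesis .
  qed
  ultimately show ?thesis using f_typ by (simp add: coalgebra_family_def)
qed

text \<open>Coalgebra morphisms over \<open>g\<close> are the arrows whose components are the
  iterated comultiplications of \<open>L\<close>. Such an arrow exists by the universal property of
  \<open>W\<close> and is unique because the \<open>q t\<close> are jointly monic.\<close>

lemma ex_cofree_coalgebra:
  assumes X: "X \<in> Ob C"
  shows "\<exists>K e. is_coalgebra C K \<and> e \<in> Hom C (Underlying K) X \<and>
    (\<forall>L g. is_coalgebra C L \<longrightarrow> g \<in> Hom C (Underlying L) X \<longrightarrow>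
      (\<exists>!h. is_coalgebra_morphism C L K h \<and> e \<cdot> h = g))"
proof -
  have pow [simp]: "tensor_power X t \<in> Ob C" for t using X by simp
  obtain W q \<delta> where family: "coalgebra_family X W q" and \<delta>: "\<delta> \<in> Hom C W (W \<odot> W)"
    and q\<delta> [simp]: "\<And>s t. (q s \<boxtimes> q t) \<cdot> \<delta> = q (Join s t)"
    and q_jm: "jointly_monic C W q" and qq_jm: "jointly_monic C (W \<odot> W) (\<lambda>(s, t). q s \<boxtimes> q t)"
    and qqq_jm: "jointly_monic C (W \<odot> (W \<odot> W)) (\<lambda>(r, s, t). q r \<boxtimes> (q s \<boxtimes> q t))"
    and univ: "\<And>A f d. \<lbrakk>coalgebra_family X A f; d \<in> Hom C A (A \<odot> A);
      \<And>s t. (f s \<boxtimes> f t) \<cdot> d = f (Join s t)\<rbrakk> \<Longrightarrow> \<exists>h \<in> Hom C A W. \<forall>t. q t \<cdot> h = f t"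
    using ex_universal_coalgebra_family[OF X] by blast
  have W [simp]: "W \<in> Ob C" and q_typ: "\<And>t. q t \<in> Hom C W (tensor_power X t)"
    and assoc: "\<And>r s t. Assoc C (tensor_power X r) (tensor_power X s) (tensor_power X t) \<cdot> q (Join (Join r s) t)
      = q (Join r (Join s t))"
    and lunit: "\<And>t. LUnit C (tensor_power X t) \<cdot> q (Join Empty t) = q t"
    and runit: "\<And>t. RUnit C (tensor_power X t) \<cdot> q (Join t Empty) = q t"
    using family by (auto simp: coalgebra_family_def)
  have qA [simp]: "q t \<in> Arr C" "Dom C (q t) = W" "Cod C (q t) = tensor_power X t" for t
    using q_typ by (simp_all add: in_Hom_iff)
  have \<delta>A [simp]: "\<delta> \<in> Arr C" "Dom C \<delta> = W" "Cod C \<delta> = W \<odot> W"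
    using \<delta> by (simp_all add: in_Hom_iff)
  \<comment> \<open>The counit is the component at the empty bracketing, whose power is the unit
    object; the universal arrow to \<open>X\<close> will be the component at
    \<open>Var\<close>.\<close>
  let ?K = "\<lparr>Underlying = W, Comult = \<delta>, Counit = q Empty\<rparr>"
  have coassoc: "Assoc C W W W \<cdot> (\<delta> \<boxtimes> Idn C W) \<cdot> \<delta> = (Idn C W \<boxtimes> \<delta>) \<cdot> \<delta>"
  proof (rule jointly_monic_cancel[OF qqq_jm])
    fix x :: "bracketing \<times> bracketing \<times> bracketing"
    obtain r s t where x: "x = (r, s, t)" by (cases x)
    have "(q r \<boxtimes> (q s \<boxtimes> q t)) \<cdot> Assoc C W W W \<cdot> (\<delta> \<boxtimes> Idn C W) \<cdot> \<delta>
        = ((q r \<boxtimes> (q s \<boxtimes> q t)) \<cdot> Assoc C W W W) \<cdot> (\<delta> \<boxtimes> Idn C W) \<cdot> \<delta>" by simp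
    also have "\<dots> = Assoc C (tensor_power X r) (tensor_power X s) (tensor_power X t) \<cdot> ((q r \<boxtimes> q s) \<boxtimes> q t) \<cdot> (\<delta> \<boxtimes> Idn C W) \<cdot> \<delta>"
      unfolding Assoc_natural[OF q_typ q_typ q_typ, symmetric] by simp
    also have "\<dots> = q (Join r (Join s t))" by (simp add: assoc)
    also have "\<dots> = (q r \<boxtimes> (q s \<boxtimes> q t)) \<cdot> (Idn C W \<boxtimes> \<delta>) \<cdot> \<delta>" by simp
    finally show "(case x of (r, s, t) \<Rightarrow> q r \<boxtimes> (q s \<boxtimes> q t)) \<cdot> Assoc C W W W \<cdot> (\<delta> \<boxtimes> Idn C W) \<cdot> \<delta>
        = (case x of (r, s, t) \<Rightarrow> q r \<boxtimes> (q s \<boxtimes> q t)) \<cdot> (Idn C W \<boxtimes> \<delta>) \<cdot> \<delta>"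
      by (simp only: x prod.case)
  qed simp_all
  have counit_l: "LUnit C W \<cdot> (q Empty \<boxtimes> Idn C W) \<cdot> \<delta> = Idn C W"
  proof (rule jointly_monic_cancel[OF q_jm])
    fix t
    have "q t \<cdot> LUnit C W \<cdot> (q Empty \<boxtimes> Idn C W) \<cdot> \<delta>
        = (q t \<cdot> LUnit C W) \<cdot> (q Empty \<boxtimes> Idn C W) \<cdot> \<delta>" by simp
    also have "\<dots> = LUnit C (tensor_power X t) \<cdot> (Idn C (TUnit C) \<boxtimes> q t) \<cdot> (q Empty \<boxtimes> Idn C W) \<cdot> \<delta>"
      unfolding LUnit_natural[OF q_typ, symmetric] by simp
    also have "\<dots> = q t \<cdot> Idn C W" by (simp add: lunit)
    finally show "q t \<cdot> LUnit C W \<cdot> (q Empty \<boxtimes> Idn C W) \<cdot> \<delta> = q t \<cdot> Idn C W" .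
  qed simp_all
  have counit_r: "RUnit C W \<cdot> (Idn C W \<boxtimes> q Empty) \<cdot> \<delta> = Idn C W"
  proof (rule jointly_monic_cancel[OF q_jm])
    fix t
    have "q t \<cdot> RUnit C W \<cdot> (Idn C W \<boxtimes> q Empty) \<cdot> \<delta>
        = (q t \<cdot> RUnit C W) \<cdot> (Idn C W \<boxtimes> q Empty) \<cdot> \<delta>" by simp
    also have "\<dots> = RUnit C (tensor_power X t) \<cdot> (q t \<boxtimes> Idn C (TUnit C)) \<cdot> (Idn C W \<boxtimes> q Empty) \<cdot> \<delta>"
      unfolding RUnit_natural[OF q_typ, symmetric] by simp
    also have "\<dots> = q t \<cdot> Idn C W" by (simp add: runit)
    finally show "q t \<cdot> RUnit C W \<cdot> (Idn C W \<boxtimes> q Empty) \<cdot> \<delta> = q t \<cdot> Idn C W" .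
  qed simp_all
  have "is_coalgebra C ?K"
    using coassoc counit_l counit_r by (simp add: is_coalgebra_def in_Hom_iff)
  moreover have "q Var \<in> Hom C W X" using q_typ[of Var] by simp
  moreover have "\<exists>!h. is_coalgebra_morphism C L ?K h \<and> q Var \<cdot> h = g"
    if L: "is_coalgebra C L" and g: "g \<in> Hom C (Underlying L) X" for L g
  proof -
    let ?A = "Underlying L" and ?d = "Comult L" and ?f = "iterated_comult L g"
    have d [simp]: "?d \<in> Arr C" "Dom C ?d = ?A" "Cod C ?d = ?A \<odot> ?A" and [simp]: "?A \<in> Ob C"
      using L by (auto simp: is_coalgebra_def Let_def in_Hom_iff)
    \<comment> \<open>From left to right by induction on the bracketing: the counit condition
      handles \<open>Empty\<close>, the condition over \<open>g\<close> handles \<open>Var\<close>,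
      and compatibility with comultiplication handles \<open>Join\<close>. Conversely,
      \<open>Empty\<close> and \<open>Var\<close> return the first two conditions, and the
      \<open>Join\<close> components determine the third.\<close>
    have iff: "is_coalgebra_morphism C L ?K h \<and> q Var \<cdot> h = g \<longleftrightarrow>
        h \<in> Hom C ?A W \<and> (\<forall>t. q t \<cdot> h = ?f t)" for h
    proof
      assume *: "is_coalgebra_morphism C L ?K h \<and> q Var \<cdot> h = g"
      then have h: "h \<in> Arr C" "Dom C h = ?A" "Cod C h = W" and
        mor: "\<delta> \<cdot> h = (h \<boxtimes> h) \<cdot> ?d" "q Empty \<cdot> h = Counit L"
        by (auto simp: is_coalgebra_morphism_def in_Hom_iff)
      have "q t \<cdot> h = ?f t" for t
      proof (induction t)
        case (Join s t)
        have "q (Join s t) \<cdot> h = ((q s \<boxtimes> q t) \<cdot> \<delta>) \<cdot> h" by simp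
        also have "\<dots> = (q s \<boxtimes> q t) \<cdot> \<delta> \<cdot> h" by (rule Comp_assoc_Arr) (use h in simp_all)
        also have "\<dots> = ((q s \<cdot> h) \<boxtimes> (q t \<cdot> h)) \<cdot> ?d" unfolding mor using h by simp
        finally show ?case by (simp add: Join.IH)
      qed (use * mor in simp_all)
      then show "h \<in> Hom C ?A W \<and> (\<forall>t. q t \<cdot> h = ?f t)" using h by (simp add: in_Hom_iff)
    next
      assume "h \<in> Hom C ?A W \<and> (\<forall>t. q t \<cdot> h = ?f t)"
      then have h: "h \<in> Arr C" "Dom C h = ?A" "Cod C h = W" and qh: "\<And>t. q t \<cdot> h = ?f t"
        by (auto simp: in_Hom_iff)
      have "\<delta> \<cdot> h = (h \<boxtimes> h) \<cdot> ?d"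
      proof (rule jointly_monic_cancel[OF qq_jm])
        fix x :: "bracketing \<times> bracketing"
        obtain s t where x: "x = (s, t)" by (cases x)
        have "(q s \<boxtimes> q t) \<cdot> \<delta> \<cdot> h = ((q s \<boxtimes> q t) \<cdot> \<delta>) \<cdot> h"
          by (rule Comp_assoc_Arr[symmetric]) (use h in simp_all)
        also have "\<dots> = (q s \<boxtimes> q t) \<cdot> (h \<boxtimes> h) \<cdot> ?d" using h by (simp add: qh)
        finally show "(case x of (s, t) \<Rightarrow> q s \<boxtimes> q t) \<cdot> \<delta> \<cdot> h
            = (case x of (s, t) \<Rightarrow> q s \<boxtimes> q t) \<cdot> (h \<boxtimes> h) \<cdot> ?d"
          by (simp only: x prod.case)
      qed (use h in simp_all)
      then show "is_coalgebra_morphism C L ?K h \<and> q Var \<cdot> h = g"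
        using h qh[of Var] qh[of Empty] by (simp add: is_coalgebra_morphism_def in_Hom_iff)
    qed
    obtain h where h: "h \<in> Hom C ?A W" "\<forall>t. q t \<cdot> h = ?f t"
      using univ[OF coalgebra_family_iterated_comult[OF L g X], of ?d] by (auto simp: in_Hom_iff)
    have "h' = h" if "h' \<in> Hom C ?A W \<and> (\<forall>t. q t \<cdot> h' = ?f t)" for h'
      by (rule jointly_monic_cancel[OF q_jm]) (use that h in \<open>simp_all add: in_Hom_iff\<close>)
    with h show ?thesis unfolding iff by blast
  qed
  ultimately show ?thesis
    by (intro exI[of _ ?K] exI[of _ "q Var"]) simp
qed

end

section \<open>Cofree coalgebras as universal arrows for the forgetful functor\<close>

theorem theorem3p37:
  fixes C :: "('o, 'a, 'm) tensor_category_scheme"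
  assumes "abelian_tensor_category C"
    and "has_countable_products C"
    and "tensor_exact C"
    and "countable_product_tensor_mono C"
    and "tensor_commutes_countable_intersections C"
  shows "has_right_adjoint (Coalg C) C forgetful"
proof -
  interpret abelian_tensor_category C by (rule assms(1))
  interpret cofree_setting C by unfold_locales (use assms in simp_all)
  show ?thesis
  proof (rule has_right_adjoint_if_universal_arrows[OF is_functor_forgetful])
    fix X assume "X \<in> Ob C"
    then obtain K e where K: "is_coalgebra C K" and e: "e \<in> Hom C (Underlying K) X"
      and univ: "\<And>L g. \<lbrakk>is_coalgebra C L; g \<in> Hom C (Underlying L) X\<rbrakk> \<Longrightarrow>
        \<exists>!h. is_coalgebra_morphism C L K h \<and> e \<cdot>\<^bsub>C\<^esub> h = g"
      using ex_cofree_coalgebra by blast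
    have "\<exists>!h. h \<in> Hom (Coalg C) L K \<and> e \<cdot>\<^bsub>C\<^esub> ArrMap forgetful h = g"
      if L: "L \<in> Ob (Coalg C)" and g: "g \<in> Hom C (ObMap forgetful L) X" for L g
    proof -
      have L': "is_coalgebra C L" using L by (simp add: Coalg_def)
      \<comment> \<open>An arrow of \<open>Coalg C\<close> carries its endpoints, so with
        \<open>L\<close> and \<open>K\<close> fixed it amounts to its middle component and unique
        existence passes over to triples.\<close>
      have Hom: "k \<in> Hom (Coalg C) L K \<longleftrightarrow> (\<exists>h. k = (L, h, K) \<and> is_coalgebra_morphism C L K h)" for k
        using L' K by (auto simp: Coalg_def Hom_def)
      have "\<exists>!h. is_coalgebra_morphism C L K h \<and> e \<cdot>\<^bsub>C\<^esub> h = g"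
        using univ[OF L'] g by (simp add: forgetful_def)
      then obtain h where h: "is_coalgebra_morphism C L K h" "e \<cdot>\<^bsub>C\<^esub> h = g"
        and unique: "\<And>h'. \<lbrakk>is_coalgebra_morphism C L K h'; e \<cdot>\<^bsub>C\<^esub> h' = g\<rbrakk> \<Longrightarrow> h' = h" by metis
      show ?thesis
      proof (rule ex1I[of _ "(L, h, K)"])
        show "(L, h, K) \<in> Hom (Coalg C) L K \<and> e \<cdot>\<^bsub>C\<^esub> ArrMap forgetful (L, h, K) = g"
          using h by (simp add: Hom forgetful_def)
        show "k = (L, h, K)" if "k \<in> Hom (Coalg C) L K \<and> e \<cdot>\<^bsub>C\<^esub> ArrMap forgetful k = g" for k
          using that unique by (auto simp: Hom forgetful_def)
      qed
    qed
    then show "\<exists>K \<in> Ob (Coalg C). \<exists>e \<in> Hom C (ObMap forgetful K) X. \<forall>L \<in> Ob (Coalg C).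
        \<forall>g \<in> Hom C (ObMap forgetful L) X.
          \<exists>!h. h \<in> Hom (Coalg C) L K \<and> e \<cdot>\<^bsub>C\<^esub> ArrMap forgetful h = g"
      using K e by (intro bexI[of _ K] bexI[of _ e]) (simp_all add: Coalg_def forgetful_def)
  qed
qed

end
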